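(* Let $s\in\mathbb{R}$, $1\le p,q\le\infty$ and $d=2,3$, where the parameters $p,q,s$ are such that the local existence and uniqueness result for the incompressible Euler equations in $B^s_{p,q}$ holds (that is, $s>1+d/p$). The data-to-solution map $u_0\mapsto u$ of the incompressible Euler equations is not uniformly continuous from the unit ball in $B^s_{p,q}(\mathbb{T}^d)$ into $C\left([0,T],B^s_{p,q}(\mathbb{T}^d,\mathbb{R}^d)\right)$.
   Context: $\mathbb{T}^d$ is the $d$-dimensional torus (functions on it are $2\pi$-periodic in each variable). The Cauchy problem for the incompressible Euler equations on $\mathbb{T}^d$ is $$\partial_t u+(u\cdot\nabla)u+\nabla \pi=0,\qquad \operatorname{div}u=0,\qquad u(0,x)=u_0(x),$$ where $u(t,x)\in\mathbb{R}^d$ is the velocity field, $\pi(t,x)\in\mathbb{R}$ is the pressure, and $u_0:\mathbb{T}^d\to\mathbb{R}^d$ is the divergence-free initial velocity. Besov spaces: let $\varphi_0$ be a smooth bump function on $\mathbb{R}^d$ supported in the ball of radius $2$ and equal to $1$ on the ball of radius $1$; let $\varphi_1(\xi)=\varphi_0(\xi/2)-\varphi_0(\xi)$ and $\varphi_j(\xi)=\varphi_1(\xi/2^{j-1})$ for $j\in\mathbb{N}$. Let $\varphi_j(D)$ be the Fourier multiplier operator with symbol $\varphi_j$ (acting on Fourier coefficients). For $s\in\mathbb{R}$, $1\le p,q\le\infty$, $B^s_{p,q}(\mathbb{T}^d)$ is the space of (vector-valued) distributions $f$ on $\mathbb{T}^d$ with finite norm $$\|f\|_{B^s_{p,q}}=\Big(\sum_{j\ge0}2^{jsq}\|\varphi_j(D)f\|_{L^p}^q\Big)^{1/q}\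 (q<\infty),\qquad \|f\|_{B^s_{p,\infty}}=\sup_{j\ge0}2^{js}\|\varphi_j(D)f\|_{L^p}.$$ Data-to-solution map: the local existence and uniqueness result referred to is that, if $1\le p,q\le\infty$, $s>1+d/p$ and $u_0\in B^s_{p,q}$ satisfies $\operatorname{div}u_0=0$, then there is $T=T(u_0)$ such that the Euler Cauchy problem has a unique solution $u\in C([0,T];B^s_{p,q})$. The data-to-solution map sends $u_0$ to this solution $u$; $T$ denotes a local existence time. *)

theory Defs
  imports "HOL-Analysis.Analysis" "HOL-Probability.Essential_Supremum"
begin

definition partial :: "'d::finite \<Rightarrow> (real^'d \<Rightarrow> 'b::real_normed_vector) \<Rightarrow> real^'d \<Rightarrow> 'b"
  where "partial i f x = frechet_derivative f (at x) (axis i 1)"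

definition gradient :: "(real^'d \<Rightarrow> real) \<Rightarrow> real^'d \<Rightarrow> real^'d"
  where "gradient f x = (\<chi> i. partial i f x)"

text \<open>\<open>partials [i\<^sub>1, \<dots>, i\<^sub>m] f\<close> is the iterated partial derivative
  \<open>\<partial>\<^bsub>i\<^sub>1\<^esub> \<dots> \<partial>\<^bsub>i\<^sub>m\<^esub> f\<close>.\<close>

primrec partials :: "'d list \<Rightarrow> (real^('d::finite) \<Rightarrow> 'b::real_normed_vector) \<Rightarrow> real^'d \<Rightarrow> 'b"
  where
    "partials [] f = f"
  | "partials (i # is) f = partial i (partials is f)"

text \<open>\<open>C\<^sup>\<infinity>\<close>: every iterated partial derivative is (Frechet) differentiable everywhere,
  hence in particular continuous.\<close>

definition smooth :: "(real^'d \<Rightarrow> 'b::real_normed_vector) \<Rightarrow> bool"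
  where "smooth f \<longleftrightarrow> (\<forall>is x. partials is f differentiable (at x))"

definition torus_periodic :: "(real^'d \<Rightarrow> 'b) \<Rightarrow> bool"
  where "torus_periodic f \<longleftrightarrow> (\<forall>x i. f (x + axis i (2 * pi)) = f x)"

definition torus_cell :: "(real^'d) set"
  where "torus_cell = cbox 0 (\<chi> i. 2 * pi)"

definition torus_test :: "(real^'d \<Rightarrow> real) set"
  where "torus_test = {\<phi>. smooth \<phi> \<and> torus_periodic \<phi>}"

type_synonym 'd vdistr = "(real^'d \<Rightarrow> real) \<Rightarrow> real^'d"

text \<open>An \<open>\<real>\<^sup>d\<close>-valued distribution is a linear map on test functions that is continuous for the
  \<open>C\<^sup>\<infinity>\<close> topology, i.e. bounded by a multiple of some \<open>C\<^sup>N\<close> norm. The value \<open>0\<close> outside the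
  test functions is a convention which makes distributions equal as HOL functions iff they agree
  on all test functions.\<close>

definition torus_distributions :: "'d::finite vdistr set"
  where "torus_distributions = {F.
    (\<forall>\<phi>\<in>torus_test. \<forall>\<psi>\<in>torus_test. F (\<lambda>x. \<phi> x + \<psi> x) = F \<phi> + F \<psi>) \<and>
    (\<forall>\<phi>\<in>torus_test. \<forall>a. F (\<lambda>x. a * \<phi> x) = a *\<^sub>R F \<phi>) \<and>
    (\<exists>C N. \<forall>\<phi>\<in>torus_test. \<forall>M.
        (\<forall>is x. length is \<le> N \<longrightarrow> \<bar>partials is \<phi> x\<bar> \<le> M) \<longrightarrow> norm (F \<phi>) \<le> C * M) \<and>
    (\<forall>\<phi>. \<phi> \<notin> torus_test \<longrightarrow> F \<phi> = 0)}"

definition regular_distribution :: "(real^'d \<Rightarrow> real^'d) \<Rightarrow> 'd::finite vdistr"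
  where "regular_distribution f =
    (\<lambda>\<phi>. if \<phi> \<in> torus_test then (LINT x:torus_cell|lborel. \<phi> x *\<^sub>R f x) else 0)"

definition divergence_free :: "'d::finite vdistr \<Rightarrow> bool"
  where "divergence_free F \<longleftrightarrow> (\<forall>\<phi>\<in>torus_test. (\<Sum>i\<in>UNIV. F (partial i \<phi>) $ i) = 0)"

definition wave_vector :: "int^'d \<Rightarrow> real^'d"
  where "wave_vector k = (\<chi> i. real_of_int (k $ i))"

text \<open>\<open>(2\<pi>)\<^sup>-\<^sup>d F(e\<^sup>-\<^sup>i\<^sup>k\<^sup>\<cdot>\<^sup>x)\<close>, with the complex exponential split into real test functions.\<close>

definition fourier_coeff :: "'d::finite vdistr \<Rightarrow> int^'d \<Rightarrow> complex^'d"
  where "fourier_coeff F k =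
    (\<chi> i. Complex (F (\<lambda>x. cos (wave_vector k \<bullet> x)) $ i) (- F (\<lambda>x. sin (wave_vector k \<bullet> x)) $ i)
          / complex_of_real ((2 * pi) ^ CARD('d)))"

definition bump_function :: "(real^'d \<Rightarrow> real) \<Rightarrow> bool"
  where "bump_function \<phi>\<^sub>0 \<longleftrightarrow> smooth \<phi>\<^sub>0 \<and>
    (\<forall>\<xi>. norm \<xi> \<le> 1 \<longrightarrow> \<phi>\<^sub>0 \<xi> = 1) \<and> (\<forall>\<xi>. norm \<xi> \<ge> 2 \<longrightarrow> \<phi>\<^sub>0 \<xi> = 0)"

definition lp_symbol :: "(real^'d \<Rightarrow> real) \<Rightarrow> nat \<Rightarrow> real^'d \<Rightarrow> real"
  where "lp_symbol \<phi>\<^sub>0 j \<xi> =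
    (if j = 0 then \<phi>\<^sub>0 \<xi>
     else let \<eta> = \<xi> /\<^sub>R 2 ^ (j - 1) in \<phi>\<^sub>0 (\<eta> /\<^sub>R 2) - \<phi>\<^sub>0 \<eta>)"

text \<open>The symbols have bounded support, so the multiplier yields a trigonometric polynomial: the
  sum ranges over a finite set of frequencies.\<close>

definition lp_block :: "(real^'d \<Rightarrow> real) \<Rightarrow> nat \<Rightarrow> 'd::finite vdistr \<Rightarrow> real^'d \<Rightarrow> complex^'d"
  where "lp_block \<phi>\<^sub>0 j F x =
    (\<Sum>k | lp_symbol \<phi>\<^sub>0 j (wave_vector k) \<noteq> 0.
       \<chi> i. of_real (lp_symbol \<phi>\<^sub>0 j (wave_vector k)) * fourier_coeff F k $ i
            * cis (wave_vector k \<bullet> x))"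

definition ennreal_powr :: "ennreal \<Rightarrow> real \<Rightarrow> ennreal"
  where "ennreal_powr x r = (if x = \<infinity> then \<infinity> else ennreal (enn2real x powr r))"

definition torus_Lp_norm :: "ereal \<Rightarrow> (real^'d \<Rightarrow> 'b::real_normed_vector) \<Rightarrow> ennreal"
  where "torus_Lp_norm p f =
    (if p = \<infinity> then esssup (restrict_space lborel torus_cell) (\<lambda>x. ennreal (norm (f x)))
     else ennreal_powr
       (\<integral>\<^sup>+x\<in>torus_cell. ennreal (norm (f x) powr real_of_ereal p) \<partial>lborel) (1 / real_of_ereal p))"

definition besov_norm ::
    "(real^'d \<Rightarrow> real) \<Rightarrow> real \<Rightarrow> ereal \<Rightarrow> ereal \<Rightarrow> 'd::finite vdistr \<Rightarrow> ennreal"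
  where "besov_norm \<phi>\<^sub>0 s p q F =
    (let a = \<lambda>j. ennreal (2 powr (real j * s)) * torus_Lp_norm p (lp_block \<phi>\<^sub>0 j F) in
     if q = \<infinity> then (SUP j. a j)
     else ennreal_powr (\<Sum>j. ennreal_powr (a j) (real_of_ereal q)) (1 / real_of_ereal q))"

definition besov_space ::
    "(real^'d \<Rightarrow> real) \<Rightarrow> real \<Rightarrow> ereal \<Rightarrow> ereal \<Rightarrow> 'd::finite vdistr set"
  where "besov_space \<phi>\<^sub>0 s p q = {F \<in> torus_distributions. besov_norm \<phi>\<^sub>0 s p q F < \<infinity>}"

text \<open>Pointwise solutions of class \<open>C\<^sup>1\<close> on the closed time interval (one-sided time derivatives
  at its ends), with a pressure on the torus. For \<open>s > 1 + d/p\<close> every solution in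
  \<open>C([0,T]; B\<^sup>s\<^sub>p\<^sub>,\<^sub>q)\<close> is of this class, since \<open>B\<^sup>s\<^sub>p\<^sub>,\<^sub>q\<close> embeds into \<open>C\<^sup>1\<close> and
  \<open>\<partial>\<^sub>t u \<in> C([0,T]; B\<^sup>s\<^sup>-\<^sup>1\<^sub>p\<^sub>,\<^sub>q)\<close>.\<close>

definition classical_euler ::
    "real \<Rightarrow> (real \<Rightarrow> real^'d \<Rightarrow> real^'d) \<Rightarrow> (real \<Rightarrow> real^'d \<Rightarrow> real) \<Rightarrow> bool"
  where "classical_euler T u \<pi> \<longleftrightarrow>
    (\<forall>t\<in>{0..T}. torus_periodic (u t) \<and> torus_periodic (\<pi> t)) \<and>
    (\<forall>t\<in>{0..T}. \<forall>x. u t differentiable (at x) \<and> \<pi> t differentiable (at x) \<and>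
        (\<lambda>\<tau>. u \<tau> x) differentiable (at t within {0..T})) \<and>
    continuous_on ({0..T} \<times> UNIV) (\<lambda>(t, x). u t x) \<and>
    (\<forall>i. continuous_on ({0..T} \<times> UNIV) (\<lambda>(t, x). partial i (u t) x)) \<and>
    continuous_on ({0..T} \<times> UNIV) (\<lambda>(t, x). vector_derivative (\<lambda>\<tau>. u \<tau> x) (at t within {0..T})) \<and>
    (\<forall>t\<in>{0..T}. \<forall>x.
        vector_derivative (\<lambda>\<tau>. u \<tau> x) (at t within {0..T})
          + (\<Sum>j\<in>UNIV. u t x $ j *\<^sub>R partial j (u t) x) + gradient (\<pi> t) x = 0 \<and>
        (\<Sum>i\<in>UNIV. partial i (u t) x $ i) = 0)"

definition besov_curve ::
    "(real^'d \<Rightarrow> real) \<Rightarrow> real \<Rightarrow> ereal \<Rightarrow> ereal \<Rightarrow> real \<Rightarrow> (real \<Rightarrow> 'd::finite vdistr) \<Rightarrow> bool"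
  where "besov_curve \<phi>\<^sub>0 s p q T U \<longleftrightarrow>
    (\<forall>t\<in>{0..T}. U t \<in> besov_space \<phi>\<^sub>0 s p q \<and>
       ((\<lambda>\<tau>. besov_norm \<phi>\<^sub>0 s p q (U \<tau> - U t)) \<longlongrightarrow> 0) (at t within {0..T}))"

text \<open>Curves are normalised outside \<open>[0,T]\<close> (\<open>extensional\<close>), so that uniqueness of a solution
  means uniqueness on \<open>[0,T]\<close>.\<close>

definition euler_solution ::
    "(real^'d \<Rightarrow> real) \<Rightarrow> real \<Rightarrow> ereal \<Rightarrow> ereal \<Rightarrow> real \<Rightarrow> 'd::finite vdistr
      \<Rightarrow> (real \<Rightarrow> 'd vdistr) \<Rightarrow> bool"
  where "euler_solution \<phi>\<^sub>0 s p q T U\<^sub>0 U \<longleftrightarrow>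
    U \<in> extensional {0..T} \<and> besov_curve \<phi>\<^sub>0 s p q T U \<and> U 0 = U\<^sub>0 \<and>
    (\<exists>u \<pi>. classical_euler T u \<pi> \<and> (\<forall>t\<in>{0..T}. U t = regular_distribution (u t)))"

text \<open>The unit-ball data for which the data-to-solution map with values in \<open>C([0,T]; B\<^sup>s\<^sub>p\<^sub>,\<^sub>q)\<close>
  is defined; this is the whole divergence-free unit ball if \<open>T\<close> is a common existence time.\<close>

definition euler_data_ball ::
    "(real^'d \<Rightarrow> real) \<Rightarrow> real \<Rightarrow> ereal \<Rightarrow> ereal \<Rightarrow> real \<Rightarrow> 'd::finite vdistr set"
  where "euler_data_ball \<phi>\<^sub>0 s p q T =
    {U\<^sub>0 \<in> besov_space \<phi>\<^sub>0 s p q. besov_norm \<phi>\<^sub>0 s p q U\<^sub>0 < 1 \<and> divergence_free U\<^sub>0 \<and>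
       (\<exists>!U. euler_solution \<phi>\<^sub>0 s p q T U\<^sub>0 U)}"

definition data_to_solution ::
    "(real^'d \<Rightarrow> real) \<Rightarrow> real \<Rightarrow> ereal \<Rightarrow> ereal \<Rightarrow> real \<Rightarrow> 'd::finite vdistr
      \<Rightarrow> real \<Rightarrow> 'd vdistr"
  where "data_to_solution \<phi>\<^sub>0 s p q T U\<^sub>0 = (THE U. euler_solution \<phi>\<^sub>0 s p q T U\<^sub>0 U)"

end

theory Submission
  imports Defs
begin

text \<open>
  The map fails to be uniformly continuous because the Euler flow carries high frequencies along
  the mean velocity, so that a mean velocity which is too small to be seen by the norm still shifts
  the phase of a high-frequency wave by a fixed amount. The waves used here are exact solutions:
  for distinct coordinates \<open>i\<close>, \<open>j\<close> the flow
  \[ u(t,x) = a\, e_i + b \cos(n x_i - n a t)\, e_j \]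
  is divergence free, and since \<open>e_j\<close> is orthogonal to the only direction in which \<open>u\<close> varies, the
  nonlinearity reduces to transport with the constant speed \<open>a\<close>; the pressure vanishes.

  Take \<open>n = 2\<^sup>m\<close>, \<open>b = c n\<^sup>-\<^sup>s\<close> and the two mean velocities \<open>a = \<plusminus>1/n\<close>. The initial data differ by the
  constant \<open>2/n\<close> only, which tends to zero. At time \<open>t\<close> the phases are \<open>\<plusminus>t\<close>, and the difference of the
  waves is \<open>2 b sin t sin(n x_i)\<close>, whose Besov norm is of size \<open>c sin t\<close> for every \<open>n\<close>. The difference
  of two shear waves with equal amplitude and frequency is again a shear wave (lemma \<open>shear_diff\<close>), so
  data, solutions, differences and continuity in time are all controlled by one two-sided estimate,
  \<open>besov_norm_shear\<close>. That estimate is elementary for dyadic \<open>n\<close>: there the Littlewood-Paley symbols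
  take the values \<open>0\<close> and \<open>1\<close> only, and exactly two blocks survive, the mean and the wave.

  The waves count only if the data-to-solution map is defined at them, that is, if the solution is
  unique among all solutions in the class considered. This is an energy argument
  (\<open>classical_euler_unique\<close>): the \<open>L\<^sup>2\<close> norm of the difference of two solutions satisfies a Gronwall
  inequality, because pressure and transport only contribute the integral of a divergence. The initial
  values are given as distributions, so one also needs that a continuous function is determined
  on the cell by its integrals against test functions (\<open>test_functions_separate\<close>).
\<close>

section \<open>Periodic calculus on the fundamental cell\<close>

lemma partial_eqI: "(f has_derivative D) (at x) \<Longrightarrow> partial i f x = D (axis i 1)"
  unfolding partial_def by (metis frechet_derivative_at)

text \<open>Since \<open>partial\<close> is defined through the Frechet derivative, this is what connects it
  with one-variable calculus; it is used for differentiating under the integral.\<close>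

lemma derivative_along_axis:
  assumes "f differentiable (at (x + h *\<^sub>R axis i 1))"
  shows "((\<lambda>r. f (x + r *\<^sub>R axis i 1)) has_vector_derivative partial i f (x + h *\<^sub>R axis i 1))
           (at h within S)"
proof -
  define F where "F = frechet_derivative f (at (x + h *\<^sub>R axis i 1))"
  have F: "(f has_derivative F) (at (x + h *\<^sub>R axis i 1))"
    using assms unfolding F_def by (simp add: frechet_derivative_works)
  have "((\<lambda>r. x + r *\<^sub>R axis i 1) has_derivative (\<lambda>r. r *\<^sub>R axis i 1)) (at h within S)"
    by (auto intro!: derivative_eq_intros)
  from has_derivative_compose[OF this F]
  have "((\<lambda>r. f (x + r *\<^sub>R axis i 1)) has_derivative (\<lambda>r. F (r *\<^sub>R axis i 1))) (at h within S)" .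
  moreover have "F (r *\<^sub>R axis i 1) = r *\<^sub>R partial i f (x + h *\<^sub>R axis i 1)" for r
    using linear_cmul[OF has_derivative_linear[OF F]] partial_eqI[OF F] by simp
  ultimately show ?thesis by (simp add: has_vector_derivative_def)
qed

lemma differentiable_imp_continuous_on:
  "(\<And>x. f differentiable (at x)) \<Longrightarrow> continuous_on S f"
  by (simp add: differentiable_imp_continuous_within continuous_at_imp_continuous_on)

lemma continuous_on_cell_integrable:
  fixes f :: "real^'d \<Rightarrow> 'b::banach"
  shows "continuous_on UNIV f \<Longrightarrow> f integrable_on torus_cell"
  unfolding torus_cell_def by (intro integrable_continuous) (meson continuous_on_subset subset_UNIV)

text \<open>The translated cell is cut by the hyperplane \<open>x\<^sub>i = 2\<pi>\<close>; periodicity moves the part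
  beyond it back by one period, to the slab of the cell that the translation has left empty.\<close>

lemma integral_cell_translate:
  fixes f :: "real^'d \<Rightarrow> real"
  assumes cont: "continuous_on UNIV f" and per: "\<And>x. f (x + axis i (2 * pi)) = f x"
    and h: "0 \<le> h" "h \<le> 2 * pi"
  shows "integral torus_cell (\<lambda>x. f (x + h *\<^sub>R axis i 1)) = integral torus_cell f"
proof -
  define c :: "real^'d" where "c = (\<chi> i. 2 * pi)"
  define v :: "real^'d" where "v = h *\<^sub>R axis i 1"
  define b :: "real^'d" where "b = (\<chi> j. if j = i then h else 2 * pi)"
  define l :: "real^'d" where "l = axis i (2 * pi)"
  have int: "f integrable_on cbox x y" for x y
    by (intro integrable_continuous) (meson cont continuous_on_subset subset_UNIV)
  have box: "x \<in> cbox u w \<longleftrightarrow> (u $ i \<le> x $ i \<and> x $ i \<le> w $ i) \<and>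
      (\<forall>j. j \<noteq> i \<longrightarrow> u $ j \<le> x $ j \<and> x $ j \<le> w $ j)" for u w x :: "real^'d"
    by (metis mem_box_cart)
  have ax: "axis i a $ j = (if j = i then a else 0)" for a :: real and j
    by (simp add: axis_def)
  have "integral torus_cell (\<lambda>x. f (x + v)) = integral (cbox (0 + v) (c + v)) f"
    unfolding torus_cell_def c_def[symmetric] integral_shift_cbox_plus[symmetric]
    by (simp add: o_def add.commute)
  also have "\<dots> = integral (cbox (0 + v) (c + v) \<inter> {x. x \<bullet> axis i 1 \<le> 2 * pi}) f
      + integral (cbox (0 + v) (c + v) \<inter> {x. x \<bullet> axis i 1 \<ge> 2 * pi}) f"
    by (rule integral_split[OF int]) simp
  also have "cbox (0 + v) (c + v) \<inter> {x. x \<bullet> axis i 1 \<le> 2 * pi}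
      = cbox 0 c \<inter> {x. x \<bullet> axis i 1 \<ge> h}"
    using h by (auto simp: box v_def c_def ax inner_axis)
  also have "cbox (0 + v) (c + v) \<inter> {x. x \<bullet> axis i 1 \<ge> 2 * pi} = cbox (0 + l) (b + l)"
    using h by (auto simp: box v_def c_def b_def l_def ax inner_axis)
  also have "integral (cbox (0 + l) (b + l)) f = integral (cbox 0 b) f"
    unfolding integral_shift_cbox_plus[symmetric] using per
    by (simp add: o_def add.commute l_def)
  also have "cbox 0 b = cbox 0 c \<inter> {x. x \<bullet> axis i 1 \<le> h}"
    using h by (auto simp: box v_def c_def b_def ax inner_axis)
  also have "integral (cbox 0 c \<inter> {x. x \<bullet> axis i 1 \<ge> h}) f
      + integral (cbox 0 c \<inter> {x. x \<bullet> axis i 1 \<le> h}) f = integral (cbox 0 c) f"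
    using integral_split[OF int, of "axis i 1" 0 c h] by simp
  finally show ?thesis by (simp add: torus_cell_def c_def v_def)
qed

text \<open>The integral of \<open>x \<mapsto> f (x + h e\<^sub>i)\<close> over the cell does not depend on \<open>h\<close>, so its
  derivative in \<open>h\<close> vanishes.\<close>

lemma integral_partial_periodic:
  fixes f :: "real^'d \<Rightarrow> real"
  assumes diff: "\<And>x. f differentiable (at x)" and per: "\<And>x. f (x + axis i (2 * pi)) = f x"
    and cont: "continuous_on UNIV (partial i f)"
  shows "integral torus_cell (partial i f) = 0"
proof -
  define e :: "real^'d" where "e = axis i 1"
  have cf: "continuous_on S f" for S using diff by (rule differentiable_imp_continuous_on)
  have "((\<lambda>h. integral torus_cell (\<lambda>x. f (x + h *\<^sub>R e))) has_vector_derivative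
      integral torus_cell (\<lambda>x. partial i f (x + 0 *\<^sub>R e))) (at 0 within cbox 0 (2 * pi))"
    unfolding torus_cell_def
  proof (rule leibniz_rule_vector_derivative)
    show "((\<lambda>h. f (x + h *\<^sub>R e)) has_vector_derivative partial i f (x + h *\<^sub>R e))
        (at h within cbox 0 (2 * pi))" for h x
      unfolding e_def by (rule derivative_along_axis[OF diff])
    show "(\<lambda>x. f (x + h *\<^sub>R e)) integrable_on cbox 0 (\<chi> i. 2 * pi)" for h
      by (intro integrable_continuous continuous_on_compose2[OF cf[of UNIV]] continuous_intros) auto
    show "continuous_on (cbox 0 (2 * pi) \<times> cbox 0 (\<chi> i. 2 * pi)) (\<lambda>(h, x). partial i f (x + h *\<^sub>R e))"
      unfolding case_prod_beta
      by (intro continuous_on_compose2[OF cont] continuous_intros) auto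
  qed auto
  then have 1: "((\<lambda>h. integral torus_cell (\<lambda>x. f (x + h *\<^sub>R e))) has_vector_derivative
      integral torus_cell (partial i f)) (at 0 within cbox 0 (2 * pi))" by simp
  have "((\<lambda>h. integral torus_cell f) has_vector_derivative 0) (at 0 within cbox 0 (2 * pi))"
    by simp
  then have 2: "((\<lambda>h. integral torus_cell (\<lambda>x. f (x + h *\<^sub>R e))) has_vector_derivative 0)
      (at 0 within cbox 0 (2 * pi))"
    by (rule has_vector_derivative_transform[rotated -1])
       (auto simp: e_def integral_cell_translate[OF cf per])
  show ?thesis
    by (rule vector_derivative_unique_within_closed_interval[OF _ _ 1 2]) auto
qed

lemma partial_mult:
  fixes f g :: "real^'d \<Rightarrow> real"
  assumes "f differentiable (at x)" "g differentiable (at x)"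
  shows "partial i (\<lambda>x. f x * g x) x = f x * partial i g x + partial i f x * g x"
  using partial_eqI[OF has_derivative_mult[OF assms[unfolded frechet_derivative_works]]]
  unfolding partial_def .

lemma partial_add:
  assumes "f differentiable (at x)" "g differentiable (at x)"
  shows "partial i (\<lambda>x. f x + g x) x = partial i f x + partial i g x"
  using partial_eqI[OF has_derivative_add[OF assms[unfolded frechet_derivative_works]]]
  unfolding partial_def .

lemma partial_diff:
  assumes "f differentiable (at x)" "g differentiable (at x)"
  shows "partial i (\<lambda>x. f x - g x) x = partial i f x - partial i g x"
  using partial_eqI[OF has_derivative_diff[OF assms[unfolded frechet_derivative_works]]]
  unfolding partial_def .

lemma partial_const [simp]: "partial i (\<lambda>x. c) x = 0"
  using partial_eqI[OF has_derivative_const] .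

lemma partial_nth:
  fixes f :: "real^'d \<Rightarrow> real^'e"
  assumes "f differentiable (at x)"
  shows "partial i (\<lambda>x. f x $ k) x = partial i f x $ k"
  using partial_eqI[OF bounded_linear.has_derivative[OF bounded_linear_vec_nth
    assms[unfolded frechet_derivative_works], of k]]
  unfolding partial_def .

lemma differentiable_nth:
  fixes f :: "real^'d \<Rightarrow> real^'e"
  shows "f differentiable F \<Longrightarrow> (\<lambda>x. f x $ k) differentiable F"
  unfolding differentiable_def
  using bounded_linear.has_derivative[OF bounded_linear_vec_nth] by blast

lemma integral_by_parts_periodic:
  fixes f g :: "real^'d \<Rightarrow> real"
  assumes f: "\<And>x. f differentiable (at x)" "torus_periodic f" "continuous_on UNIV (partial i f)"
    and g: "\<And>x. g differentiable (at x)" "torus_periodic g" "continuous_on UNIV (partial i g)"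
  shows "integral torus_cell (\<lambda>x. f x * partial i g x) = - integral torus_cell (\<lambda>x. partial i f x * g x)"
proof -
  have cf: "continuous_on UNIV f" and cg: "continuous_on UNIV g"
    using f(1) g(1) by (auto intro: differentiable_imp_continuous_on)
  have eq: "partial i (\<lambda>x. f x * g x) = (\<lambda>x. f x * partial i g x + partial i f x * g x)"
    using partial_mult[OF f(1) g(1)] by auto
  have "integral torus_cell (\<lambda>x. f x * partial i g x + partial i f x * g x) = 0"
    unfolding eq[symmetric]
  proof (rule integral_partial_periodic)
    show "(\<lambda>x. f x * g x) differentiable at x" for x using f(1) g(1) by simp
    show "f (x + axis i (2 * pi)) * g (x + axis i (2 * pi)) = f x * g x" for x
      using f(2) g(2) by (simp add: torus_periodic_def)
    show "continuous_on UNIV (partial i (\<lambda>x. f x * g x))" unfolding eq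
      by (intro continuous_intros cf cg f g)
  qed
  then show ?thesis
    by (subst (asm) integral_add)
       (auto intro!: continuous_on_cell_integrable continuous_intros cf cg f g)
qed

section \<open>Uniqueness of classical Euler solutions\<close>

lemma continuous_on_slice:
  assumes "continuous_on (A \<times> UNIV) (\<lambda>(t, x). g t x)" "t \<in> A"
  shows "continuous_on S (g t)"
proof -
  have "continuous_on S (\<lambda>x. (\<lambda>(t, x). g t x) (t, x))"
    by (rule continuous_on_compose2[OF assms(1)]) (auto intro!: continuous_intros simp: assms(2))
  then show ?thesis by simp
qed

lemma classical_euler_time_derivative:
  assumes "classical_euler T u \<pi>" "t \<in> {0..T}"
  shows "vector_derivative (\<lambda>\<tau>. u \<tau> x) (at t within {0..T})
    = - (\<Sum>j\<in>UNIV. u t x $ j *\<^sub>R partial j (u t) x) - gradient (\<pi> t) x"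
proof -
  have "vector_derivative (\<lambda>\<tau>. u \<tau> x) (at t within {0..T})
          + (\<Sum>j\<in>UNIV. u t x $ j *\<^sub>R partial j (u t) x) + gradient (\<pi> t) x = 0"
    using assms unfolding classical_euler_def by blast
  then show ?thesis by (simp add: algebra_simps eq_neg_iff_add_eq_0)
qed

text \<open>The definition asks for a merely differentiable pressure, but the equation expresses its
  gradient by continuous quantities. The divergence of \<open>w P\<close> in the energy estimate is integrated
  with this continuity.\<close>

lemma classical_euler_pressure_C1:
  assumes "classical_euler T u \<pi>" "t \<in> {0..T}"
  shows "continuous_on UNIV (partial i (\<pi> t))"
proof -
  have ut: "continuous_on UNIV (\<lambda>x. vector_derivative (\<lambda>\<tau>. u \<tau> x) (at t within {0..T}))"
    and u: "continuous_on UNIV (u t)" and du: "\<And>j. continuous_on UNIV (partial j (u t))"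
  proof -
    have "continuous_on ({0..T} \<times> UNIV) (\<lambda>(t, x). u t x)"
      "\<And>i. continuous_on ({0..T} \<times> UNIV) (\<lambda>(t, x). partial i (u t) x)"
      "continuous_on ({0..T} \<times> UNIV)
        (\<lambda>(t, x). vector_derivative (\<lambda>\<tau>. u \<tau> x) (at t within {0..T}))"
      using assms(1) unfolding classical_euler_def by blast+
    from this[THEN continuous_on_slice, OF assms(2)]
    show "continuous_on UNIV (\<lambda>x. vector_derivative (\<lambda>\<tau>. u \<tau> x) (at t within {0..T}))"
      "continuous_on UNIV (u t)" "\<And>j. continuous_on UNIV (partial j (u t))" by blast+
  qed
  have eq: "partial i (\<pi> t) x = (- vector_derivative (\<lambda>\<tau>. u \<tau> x) (at t within {0..T})
        - (\<Sum>j\<in>UNIV. u t x $ j *\<^sub>R partial j (u t) x)) $ i" for x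
    unfolding classical_euler_time_derivative[OF assms] by (simp add: gradient_def)
  have "partial i (\<pi> t) = (\<lambda>x. (- vector_derivative (\<lambda>\<tau>. u \<tau> x) (at t within {0..T})
        - (\<Sum>j\<in>UNIV. u t x $ j *\<^sub>R partial j (u t) x)) $ i)"
    using eq by blast
  then show ?thesis
    using ut u du by (simp only:) (intro continuous_intros)
qed

lemma partial_norm_square:
  fixes w :: "real^'d \<Rightarrow> real^'d"
  assumes "w differentiable (at x)"
  shows "partial i (\<lambda>x. w x \<bullet> w x) x = 2 * (w x \<bullet> partial i w x)"
  using partial_eqI[OF has_derivative_inner[OF assms[unfolded frechet_derivative_works]
      assms[unfolded frechet_derivative_works]]]
  unfolding partial_def by (simp add: inner_commute)

text \<open>The integrand is half the divergence of \<open>u |w|\<^sup>2 + 2 w P\<close>, because \<open>u\<close> and \<open>w\<close> are divergence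
  free. This is why neither transport by \<open>u\<close> nor the pressure contributes to the energy of the
  difference \<open>w\<close> of two solutions.\<close>

lemma euler_energy_flux:
  fixes u w :: "real^'d \<Rightarrow> real^'d" and P :: "real^'d \<Rightarrow> real"
  assumes u: "\<And>x. u differentiable (at x)" "torus_periodic u" "\<And>i. continuous_on UNIV (partial i u)"
      "\<And>x. (\<Sum>i\<in>UNIV. partial i u x $ i) = 0"
    and w: "\<And>x. w differentiable (at x)" "torus_periodic w" "\<And>i. continuous_on UNIV (partial i w)"
      "\<And>x. (\<Sum>i\<in>UNIV. partial i w x $ i) = 0"
    and P: "\<And>x. P differentiable (at x)" "torus_periodic P" "\<And>i. continuous_on UNIV (partial i P)"
  shows "integral torus_cell (\<lambda>x. \<Sum>i\<in>UNIV. u x $ i * (w x \<bullet> partial i w x) + w x $ i * partial i P x) = 0"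
proof -
  \<comment> \<open>twice the energy flux, so that no fractions occur\<close>
  define X where "X i x = u x $ i * (w x \<bullet> w x) + 2 * (w x $ i * P x)" for i x
  have cu: "continuous_on UNIV u" and cw: "continuous_on UNIV w" and cP: "continuous_on UNIV P"
    using u(1) w(1) P(1) by (auto intro: differentiable_imp_continuous_on)
  have X: "partial i (X i) x = u x $ i * (2 * (w x \<bullet> partial i w x)) + partial i u x $ i * (w x \<bullet> w x)
      + 2 * (w x $ i * partial i P x + partial i w x $ i * P x)" for i x
    unfolding X_def
    by (simp add: partial_add partial_mult partial_nth partial_norm_square differentiable_nth
        differentiable_inner u(1) w(1) P(1))
  have cX: "continuous_on UNIV (partial i (X i))" for i
  proof -
    have "partial i (X i) = (\<lambda>x. u x $ i * (2 * (w x \<bullet> partial i w x))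
      + partial i u x $ i * (w x \<bullet> w x)
      + 2 * (w x $ i * partial i P x + partial i w x $ i * P x))" using X by blast
    then show ?thesis by (simp only:) (intro continuous_intros cu cw cP u w P)
  qed
  have sumX: "(\<Sum>i\<in>UNIV. u x $ i * (w x \<bullet> partial i w x) + w x $ i * partial i P x)
      = 1/2 * (\<Sum>i\<in>UNIV. partial i (X i) x)" for x
  proof -
    have "(\<Sum>i\<in>UNIV. partial i (X i) x)
      = 2 * (\<Sum>i\<in>UNIV. u x $ i * (w x \<bullet> partial i w x) + w x $ i * partial i P x)
        + (\<Sum>i\<in>UNIV. partial i u x $ i) * (w x \<bullet> w x) + 2 * ((\<Sum>i\<in>UNIV. partial i w x $ i) * P x)"
      unfolding X sum_distrib_left sum_distrib_right sum.distrib[symmetric]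
      by (rule sum.cong) (auto simp: algebra_simps)
    then show ?thesis by (simp add: u(4) w(4))
  qed
  have "integral torus_cell (\<lambda>x. \<Sum>i\<in>UNIV. partial i (X i) x)
      = (\<Sum>i\<in>UNIV. integral torus_cell (partial i (X i)))"
    by (subst integral_sum) (auto intro!: continuous_on_cell_integrable cX)
  moreover have "integral torus_cell (partial i (X i)) = 0" for i
  proof (rule integral_partial_periodic[OF _ _ cX])
    show "X i differentiable at x" for x
      unfolding X_def by (auto intro!: differentiable_nth u(1) w(1) P(1) differentiable_add
          differentiable_mult differentiable_inner)
    show "X i (x + axis i (2 * pi)) = X i x" for x
      using u(2) w(2) P(2) by (simp add: X_def torus_periodic_def)
  qed
  ultimately show ?thesis unfolding sumX by simp
qed

text \<open>With \<open>w = u - v\<close> and \<open>P = \<pi> - \<rho>\<close>, subtracting the equations gives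
  \<open>w\<^sub>t = - (u \<cdot> \<nabla>) w - (w \<cdot> \<nabla>) v - \<nabla>P\<close>. Tested against \<open>w\<close>, the first and last terms integrate to zero by
  \<open>euler_energy_flux\<close>, and the middle one is at most a multiple of the energy because \<open>\<nabla>v\<close> is bounded
  on the compact set \<open>[0,T] \<times> cell\<close>. Gronwall's inequality keeps the energy at its initial value zero.\<close>

lemma classical_euler_unique:
  fixes u v :: "real \<Rightarrow> real^'d \<Rightarrow> real^'d"
  assumes u: "classical_euler T u \<pi>" and v: "classical_euler T v \<rho>" and T: "0 < T"
    and init: "\<And>x. x \<in> torus_cell \<Longrightarrow> u 0 x = v 0 x"
    and t: "t \<in> {0..T}" and x: "x \<in> torus_cell"
  shows "u t x = v t x"
proof -
  define w where "w t x = u t x - v t x" for t x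
  define ut where "ut t x = vector_derivative (\<lambda>\<tau>. u \<tau> x) (at t within {0..T})" for t x
  define vt where "vt t x = vector_derivative (\<lambda>\<tau>. v \<tau> x) (at t within {0..T})" for t x
  define E where "E t = integral torus_cell (\<lambda>x. w t x \<bullet> w t x)" for t
  have U: "torus_periodic (u t)" "torus_periodic (\<pi> t)" "u t differentiable (at x)"
      "\<pi> t differentiable (at x)" "(\<Sum>i\<in>UNIV. partial i (u t) x $ i) = 0"
      "((\<lambda>\<tau>. u \<tau> x) has_vector_derivative ut t x) (at t within {0..T})"
    if "t \<in> {0..T}" for t x
    using u that unfolding classical_euler_def ut_def vector_derivative_works by blast+
  have V: "torus_periodic (v t)" "torus_periodic (\<rho> t)" "v t differentiable (at x)"
      "\<rho> t differentiable (at x)" "(\<Sum>i\<in>UNIV. partial i (v t) x $ i) = 0"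
      "((\<lambda>\<tau>. v \<tau> x) has_vector_derivative vt t x) (at t within {0..T})"
    if "t \<in> {0..T}" for t x
    using v that unfolding classical_euler_def vt_def vector_derivative_works by blast+
  have contu: "continuous_on ({0..T} \<times> UNIV) (\<lambda>(t, x). u t x)"
    "\<And>i. continuous_on ({0..T} \<times> UNIV) (\<lambda>(t, x). partial i (u t) x)"
    "continuous_on ({0..T} \<times> UNIV) (\<lambda>(t, x). ut t x)"
    using u unfolding classical_euler_def ut_def by blast+
  have contv: "continuous_on ({0..T} \<times> UNIV) (\<lambda>(t, x). v t x)"
    "\<And>i. continuous_on ({0..T} \<times> UNIV) (\<lambda>(t, x). partial i (v t) x)"
    "continuous_on ({0..T} \<times> UNIV) (\<lambda>(t, x). vt t x)"
    using v unfolding classical_euler_def vt_def by blast+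
  have cw: "continuous_on UNIV (w t)" and cdu: "\<And>i. continuous_on UNIV (partial i (u t))"
    and cdv: "\<And>i. continuous_on UNIV (partial i (v t))"
    and cut: "continuous_on UNIV (ut t)" and cvt: "continuous_on UNIV (vt t)"
    and cu: "continuous_on UNIV (u t)"
    if "t \<in> {0..T}" for t
    using contu[THEN continuous_on_slice, OF that] contv[THEN continuous_on_slice, OF that]
    unfolding w_def by (auto intro: continuous_on_diff)
  have dw: "partial i (w t) x = partial i (u t) x - partial i (v t) x" if "t \<in> {0..T}" for i t x
    unfolding w_def using U(3) V(3) that by (intro partial_diff) auto
  have cdw: "continuous_on UNIV (partial i (w t))" if "t \<in> {0..T}" for i t
  proof -
    have "partial i (w t) = (\<lambda>x. partial i (u t) x - partial i (v t) x)" using dw[OF that] by blast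
    then show ?thesis using cdu cdv that by (simp add: continuous_on_diff)
  qed

  have E': "(E has_vector_derivative integral torus_cell (\<lambda>x. 2 * (w t x \<bullet> (ut t x - vt t x))))
      (at t within {0..T})" if t: "t \<in> {0..T}" for t
    unfolding E_def torus_cell_def
  proof (rule leibniz_rule_vector_derivative)
    show "((\<lambda>t. w t x \<bullet> w t x) has_vector_derivative 2 * (w t x \<bullet> (ut t x - vt t x)))
        (at t within {0..T})" if "t \<in> {0..T}" for t x
    proof -
      have "((\<lambda>\<tau>. w \<tau> x) has_derivative (\<lambda>h. h *\<^sub>R (ut t x - vt t x))) (at t within {0..T})"
        using has_vector_derivative_diff[OF U(6)[OF that] V(6)[OF that]]
        unfolding has_vector_derivative_def w_def .
      from has_derivative_inner[OF this this] show ?thesis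
        unfolding has_vector_derivative_def by (simp add: inner_commute algebra_simps)
    qed
    show "(\<lambda>x. w t x \<bullet> w t x) integrable_on cbox 0 (\<chi> i. 2 * pi)" if "t \<in> {0..T}" for t
      unfolding torus_cell_def[symmetric]
      by (intro continuous_on_cell_integrable continuous_intros cw that)
    have sub: "{0..T} \<times> cbox 0 (\<chi> i. 2 * pi) \<subseteq> {0..T} \<times> (UNIV :: (real^'d) set)" by auto
    show "continuous_on ({0..T} \<times> cbox 0 (\<chi> i. 2 * pi)) (\<lambda>(t, x). 2 * (w t x \<bullet> (ut t x - vt t x)))"
      using contu contv unfolding case_prod_beta w_def
      by (intro continuous_intros continuous_on_subset[OF _ sub]) auto
  qed (use t in auto)

  have "\<exists>L. \<forall>t\<in>{0..T}. \<forall>x\<in>torus_cell. norm (partial j (v t) x) \<le> L" for j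
  proof -
    have "compact ({0..T} \<times> (torus_cell :: (real^'d) set))"
      unfolding torus_cell_def by (intro compact_Times) auto
    moreover have "continuous_on ({0..T} \<times> torus_cell) (\<lambda>(t, x). partial j (v t) x)"
      using contv(2) by (rule continuous_on_subset) auto
    ultimately have "bounded ((\<lambda>(t, x). partial j (v t) x) ` ({0..T} \<times> torus_cell))"
      by (intro compact_imp_bounded compact_continuous_image)
    then show ?thesis unfolding bounded_iff by fastforce
  qed
  then obtain L where L: "\<And>j t x. t \<in> {0..T} \<Longrightarrow> x \<in> torus_cell \<Longrightarrow> norm (partial j (v t) x) \<le> L j"
    by metis
  \<comment> \<open>the Gronwall constant: twice a bound for the velocity gradient of \<open>v\<close>\<close>
  define K where "K = 2 * (\<Sum>j\<in>UNIV. L j)"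

  have E'_le: "integral torus_cell (\<lambda>x. 2 * (w t x \<bullet> (ut t x - vt t x))) \<le> K * E t"
    if t: "t \<in> {0..T}" for t
  proof -
    define P where "P x = \<pi> t x - \<rho> t x" for x
    \<comment> \<open>the energy balance splits into a divergence and the stretching of \<open>w\<close> by \<open>\<nabla>v\<close>\<close>
    define flux where "flux x = (\<Sum>i\<in>UNIV. u t x $ i * (w t x \<bullet> partial i (w t) x)
        + w t x $ i * partial i P x)" for x
    define stretch where "stretch x = (\<Sum>j\<in>UNIV. w t x $ j * (w t x \<bullet> partial j (v t) x))" for x
    have dP: "partial i P x = partial i (\<pi> t) x - partial i (\<rho> t) x" for i x
      unfolding P_def using U(4) V(4) t by (intro partial_diff) auto
    have cdP: "continuous_on UNIV (partial i P)" for i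
    proof -
      have "partial i P = (\<lambda>x. partial i (\<pi> t) x - partial i (\<rho> t) x)" using dP by blast
      then show ?thesis
        using classical_euler_pressure_C1[OF u t] classical_euler_pressure_C1[OF v t]
        by (simp add: continuous_on_diff)
    qed
    have identity: "w t x \<bullet> (ut t x - vt t x) = - flux x - stretch x" for x
    proof -
      have grad: "w t x \<bullet> (gradient (\<pi> t) x - gradient (\<rho> t) x) = (\<Sum>i\<in>UNIV. w t x $ i * partial i P x)"
        by (simp add: inner_vec_def gradient_def dP)
      have "(\<Sum>j\<in>UNIV. u t x $ j *\<^sub>R partial j (u t) x) - (\<Sum>j\<in>UNIV. v t x $ j *\<^sub>R partial j (v t) x)
         = (\<Sum>j\<in>UNIV. u t x $ j *\<^sub>R partial j (w t) x + w t x $ j *\<^sub>R partial j (v t) x)"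
        unfolding sum_subtractf[symmetric] dw[OF t]
        by (rule sum.cong) (auto simp: w_def algebra_simps)
      then have "ut t x - vt t x
          = - (\<Sum>j\<in>UNIV. u t x $ j *\<^sub>R partial j (w t) x + w t x $ j *\<^sub>R partial j (v t) x)
            - (gradient (\<pi> t) x - gradient (\<rho> t) x)"
        unfolding ut_def vt_def classical_euler_time_derivative[OF u t]
          classical_euler_time_derivative[OF v t]
        by (simp add: algebra_simps)
      then have "w t x \<bullet> (ut t x - vt t x)
          = - (\<Sum>j\<in>UNIV. u t x $ j * (w t x \<bullet> partial j (w t) x) + w t x $ j * (w t x \<bullet> partial j (v t) x))
            - (\<Sum>i\<in>UNIV. w t x $ i * partial i P x)"
        unfolding grad[symmetric]
        by (simp add: inner_diff_right inner_sum_right inner_add_right)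
      then show ?thesis by (simp add: flux_def stretch_def sum.distrib)
    qed
    have cflux: "continuous_on UNIV flux" and cstretch: "continuous_on UNIV stretch"
      unfolding flux_def stretch_def
      by (intro continuous_intros cu[OF t] cw[OF t] cdw[OF t] cdP cdv[OF t])+
    have flux0: "integral torus_cell flux = 0"
      unfolding flux_def
    proof (rule euler_energy_flux)
      show "w t differentiable at x" "P differentiable at x" for x
        unfolding w_def P_def using U(3,4) V(3,4) t by auto
      show "torus_periodic (w t)" "torus_periodic P"
        using U(1,2)[OF t] V(1,2)[OF t] unfolding w_def P_def torus_periodic_def by auto
      show "(\<Sum>i\<in>UNIV. partial i (w t) x $ i) = 0" for x
        using U(5)[OF t] V(5)[OF t] by (simp add: dw[OF t] sum_subtractf)
    qed (use U[OF t] cdu[OF t] cdw[OF t] cdP in auto)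
    have "integral torus_cell (\<lambda>x. 2 * (w t x \<bullet> (ut t x - vt t x)))
        = integral torus_cell (\<lambda>x. - 2 * flux x + (- 2 * stretch x))"
      by (simp only: identity) (simp add: algebra_simps)
    also have "\<dots> = integral torus_cell (\<lambda>x. - 2 * stretch x)"
      by (subst integral_add)
         (auto intro!: continuous_on_cell_integrable continuous_intros cflux cstretch simp: flux0)
    also have "\<dots> \<le> integral torus_cell (\<lambda>x. K * (w t x \<bullet> w t x))"
    proof (rule integral_le)
      show "(\<lambda>x. - 2 * stretch x) integrable_on torus_cell"
        "(\<lambda>x. K * (w t x \<bullet> w t x)) integrable_on torus_cell"
        by (intro continuous_on_cell_integrable continuous_intros cstretch cw[OF t])+
      fix x :: "real^'d" assume x: "x \<in> torus_cell"
      have "- stretch x \<le> (\<Sum>j\<in>UNIV. L j * (w t x \<bullet> w t x))"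
        unfolding stretch_def sum_negf[symmetric]
      proof (rule sum_mono)
        fix j
        have "- (w t x $ j * (w t x \<bullet> partial j (v t) x)) \<le> \<bar>w t x $ j\<bar> * \<bar>w t x \<bullet> partial j (v t) x\<bar>"
          by (metis abs_ge_minus_self abs_mult)
        also have "\<dots> \<le> norm (w t x) * (norm (w t x) * L j)"
        proof (intro mult_mono component_le_norm_cart)
          show "\<bar>w t x \<bullet> partial j (v t) x\<bar> \<le> norm (w t x) * L j"
            using Cauchy_Schwarz_ineq2[of "w t x" "partial j (v t) x"]
              mult_left_mono[OF L[OF t x, of j], of "norm (w t x)"] by simp
        qed auto
        finally show "- (w t x $ j * (w t x \<bullet> partial j (v t) x)) \<le> L j * (w t x \<bullet> w t x)"
          by (simp add: power2_norm_eq_inner[symmetric] power2_eq_square mult_ac)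
      qed
      then show "- 2 * stretch x \<le> K * (w t x \<bullet> w t x)"
        by (simp add: K_def sum_distrib_right[symmetric])
    qed
    also have "\<dots> = K * E t" by (simp add: E_def)
    finally show ?thesis .
  qed

  have "E t * exp (- K * t) \<le> E 0 * exp (- K * 0)"
  proof (rule DERIV_nonpos_imp_decreasing_open[where f = "\<lambda>t. E t * exp (- K * t)"])
    show "0 \<le> t" using t by simp
    have cE: "continuous_on {0..T} E"
      unfolding continuous_on_eq_continuous_within
      using E' by (blast intro: has_vector_derivative_continuous)
    show "continuous_on {0..t} (\<lambda>t. E t * exp (- K * t))"
      by (intro continuous_intros continuous_on_subset[OF cE]) (use t in auto)
    fix r assume r: "0 < r" "r < t"
    define D where "D = integral torus_cell (\<lambda>x. 2 * (w r x \<bullet> (ut r x - vt r x)))"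
    have "(E has_real_derivative D) (at r)"
      using E'[of r] r t unfolding D_def has_real_derivative_iff_has_vector_derivative
      by (simp add: at_within_Icc_at)
    then have "((\<lambda>t. E t * exp (- K * t)) has_real_derivative (D - K * E r) * exp (- K * r)) (at r)"
      by (auto intro!: derivative_eq_intros simp: algebra_simps)
    moreover have "(D - K * E r) * exp (- K * r) \<le> 0"
      using E'_le[of r] r t unfolding D_def by (simp add: mult_nonpos_nonneg)
    ultimately show "\<exists>y. ((\<lambda>t. E t * exp (- K * t)) has_real_derivative y) (at r) \<and> y \<le> 0" by blast
  qed
  moreover have "E 0 = 0"
    unfolding E_def using init by (simp add: w_def cong: integral_cong)
  ultimately have "E t \<le> 0" by (simp add: mult_le_0_iff)
  moreover have int: "(\<lambda>x. w t x \<bullet> w t x) integrable_on torus_cell"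
    by (intro continuous_on_cell_integrable continuous_intros cw t)
  ultimately have "E t = 0"
    unfolding E_def using integral_nonneg[of "\<lambda>x. w t x \<bullet> w t x" torus_cell]
    by (metis inner_ge_zero int order_antisym)
  with int have "((\<lambda>x. w t x \<bullet> w t x) has_integral 0) torus_cell"
    unfolding E_def by (metis integrable_integral)
  then have "w t x \<bullet> w t x = 0"
    unfolding torus_cell_def
  proof (rule has_integral_0_cbox_imp_0[rotated 2])
    show "continuous_on (cbox 0 (\<chi> i. 2 * pi)) (\<lambda>x. w t x \<bullet> w t x)"
      by (intro continuous_intros continuous_on_subset[OF cw[OF t]]) auto
    show "box 0 (\<chi> i. 2 * pi) \<noteq> ({} :: (real^'d) set)"
    proof -
      have "(\<chi> i. pi) \<in> box 0 ((\<chi> i. 2 * pi) :: real^'d)" by (simp add: mem_box_cart)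
      then show ?thesis by blast
    qed
  qed (use x in \<open>auto simp: torus_cell_def\<close>)
  then show ?thesis by (simp add: w_def)
qed

section \<open>Trigonometric polynomials as test functions\<close>

text \<open>Smoothness quantifies over all iterated partial derivatives. A class of differentiable functions
  that is closed under each single \<open>partial i\<close> consists of smooth functions, and this is such a class;
  phases are included so that the derivative of a wave is again a multiple of a wave.\<close>

inductive_set trig_polynomials :: "(real^'d::finite \<Rightarrow> real) set" where
  const: "(\<lambda>x. c) \<in> trig_polynomials"
| wave: "(\<lambda>x. cos (wave_vector k \<bullet> x + \<theta>)) \<in> trig_polynomials"
| add: "f \<in> trig_polynomials \<Longrightarrow> g \<in> trig_polynomials \<Longrightarrow> (\<lambda>x. f x + g x) \<in> trig_polynomials"
| mult: "f \<in> trig_polynomials \<Longrightarrow> g \<in> trig_polynomials \<Longrightarrow> (\<lambda>x. f x * g x) \<in> trig_polynomials"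

lemma has_derivative_wave:
  "((\<lambda>x. cos (v \<bullet> x + \<theta>)) has_derivative (\<lambda>h. - sin (v \<bullet> x + \<theta>) * (v \<bullet> h))) (at x)"
  by (auto intro!: derivative_eq_intros)

lemma partial_wave: "partial i (\<lambda>x. cos (v \<bullet> x + \<theta>)) x = v $ i * cos (v \<bullet> x + (\<theta> + pi / 2))"
proof -
  have "cos (v \<bullet> x + (\<theta> + pi / 2)) = - sin (v \<bullet> x + \<theta>)"
    by (simp add: add.assoc[symmetric] minus_sin_cos_eq)
  then show ?thesis
    by (simp add: inner_axis partial_eqI[OF has_derivative_wave])
qed

lemma cos_add_int_period: "cos (a + 2 * pi * of_int n) = cos a"
  by (simp add: cos_add cos_int_2pin sin_int_2pin)

lemma periodic_wave: "torus_periodic (\<lambda>x. cos (wave_vector k \<bullet> x + \<theta>))"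
proof -
  have "wave_vector k \<bullet> (x + axis i (2 * pi)) + \<theta> = (wave_vector k \<bullet> x + \<theta>) + 2 * pi * of_int (k $ i)" for x i
    by (simp add: inner_add_right inner_axis wave_vector_def)
  then show ?thesis unfolding torus_periodic_def using cos_add_int_period by metis
qed

lemma trig_polynomial_differentiable: "f \<in> trig_polynomials \<Longrightarrow> f differentiable (at x)"
proof (induction f rule: trig_polynomials.induct)
  case (wave k \<theta>)
  show ?case using has_derivative_wave unfolding differentiable_def by blast
qed auto

lemma trig_polynomial_partial: "f \<in> trig_polynomials \<Longrightarrow> partial i f \<in> trig_polynomials"
proof (induction f rule: trig_polynomials.induct)
  case (const c)
  have "partial i (\<lambda>x. c) = (\<lambda>x. 0)" by auto
  then show ?case by (simp add: trig_polynomials.const)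
next
  case (wave k \<theta>)
  have "partial i (\<lambda>x. cos (wave_vector k \<bullet> x + \<theta>))
      = (\<lambda>x. wave_vector k $ i * cos (wave_vector k \<bullet> x + (\<theta> + pi / 2)))"
    using partial_wave by blast
  then show ?case by (simp only:) (intro trig_polynomials.intros)
next
  case (add f g)
  have "partial i (\<lambda>x. f x + g x) = (\<lambda>x. partial i f x + partial i g x)"
    using add.hyps partial_add trig_polynomial_differentiable by blast
  then show ?case using add.IH by (simp only:) (intro trig_polynomials.intros)
next
  case (mult f g)
  have "partial i (\<lambda>x. f x * g x) = (\<lambda>x. f x * partial i g x + partial i f x * g x)"
    using mult.hyps partial_mult trig_polynomial_differentiable by blast
  then show ?case using mult by (simp only:) (intro trig_polynomials.intros)
qed

lemma trig_polynomial_test: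
  assumes "f \<in> trig_polynomials"
  shows "f \<in> torus_test"
proof -
  have "partials js f \<in> trig_polynomials" for js
    by (induction js) (auto simp: assms trig_polynomial_partial)
  then have "smooth f" unfolding smooth_def using trig_polynomial_differentiable by blast
  moreover have "torus_periodic f" using assms
  proof (induction rule: trig_polynomials.induct)
    case (wave k \<theta>)
    show ?case by (rule periodic_wave)
  qed (auto simp: torus_periodic_def)
  ultimately show ?thesis by (simp add: torus_test_def)
qed

lemma trig_polynomial_sum:
  "finite A \<Longrightarrow> (\<And>a. a \<in> A \<Longrightarrow> f a \<in> trig_polynomials) \<Longrightarrow> (\<lambda>x. \<Sum>a\<in>A. f a x) \<in> trig_polynomials"
  by (induction A rule: finite_induct) (auto intro: trig_polynomials.intros)

lemma trig_polynomial_power: "f \<in> trig_polynomials \<Longrightarrow> (\<lambda>x. f x ^ n) \<in> trig_polynomials"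
  by (induction n) (auto intro: trig_polynomials.intros)

lemma torus_testD:
  fixes \<phi> :: "real^'d \<Rightarrow> real"
  assumes "\<phi> \<in> torus_test"
  shows "\<phi> differentiable (at x)" "torus_periodic \<phi>" "continuous_on S \<phi>" "partial i \<phi> \<in> torus_test"
proof -
  have s: "smooth \<phi>" and p: "torus_periodic \<phi>" using assms by (auto simp: torus_test_def)
  have d: "\<phi> differentiable (at x)" for x
    using s unfolding smooth_def by (metis partials.simps(1))
  then show "\<phi> differentiable (at x)" "continuous_on S \<phi>"
    by (auto intro: differentiable_imp_continuous_on)
  show "torus_periodic \<phi>" by (rule p)
  have "partials js (partial i \<phi>) = partials (js @ [i]) \<phi>" for js by (induction js) auto
  then have "smooth (partial i \<phi>)" using s unfolding smooth_def by simp
  moreover have "torus_periodic (partial i \<phi>)"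
    unfolding torus_periodic_def
  proof (intro allI)
    fix x :: "real^'d" and j
    have "((\<lambda>z. z + axis j (2 * pi)) has_derivative (\<lambda>h. h)) (at x)"
      by (auto intro!: derivative_eq_intros)
    from has_derivative_compose[OF this] d[of "x + axis j (2 * pi)"]
    have "((\<lambda>z. \<phi> (z + axis j (2 * pi))) has_derivative frechet_derivative \<phi> (at (x + axis j (2 * pi)))) (at x)"
      unfolding frechet_derivative_works by blast
    moreover have "(\<lambda>z. \<phi> (z + axis j (2 * pi))) = \<phi>" using p by (auto simp: torus_periodic_def)
    ultimately show "partial i \<phi> (x + axis j (2 * pi)) = partial i \<phi> x"
      by (metis partial_def partial_eqI)
  qed
  ultimately show "partial i \<phi> \<in> torus_test" by (simp add: torus_test_def)
qed

text \<open>Powers of the trigonometric polynomial \<open>h x = d + (\<Sum>i. cos (x\<^sub>i - y\<^sub>i))\<close> serve as an approximate identity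
  at \<open>y\<close>: within the cell, \<open>h\<close> has its unique maximum at \<open>y\<close>. If \<open>g y > 0\<close>, then the \<open>n\<close>-th power of \<open>h\<close>
  is at least \<open>M'\<^sup>n\<close> on a box around \<open>y\<close> where \<open>g\<close> is positive, and at most \<open>M\<^sup>n\<close> with \<open>M < M'\<close> where \<open>g\<close> may
  be negative, so for large \<open>n\<close> the integral of \<open>h\<^sup>n g\<close> would be positive. The point \<open>y\<close> has to
  be interior, since a boundary point of the cell has translates by periods in the cell, which are
  maxima of \<open>h\<close> as well.\<close>

lemma test_functions_detect_positivity:
  fixes g :: "real^'d \<Rightarrow> real"
  assumes cont: "continuous_on UNIV g"
    and zero: "\<And>\<phi>. \<phi> \<in> torus_test \<Longrightarrow> integral torus_cell (\<lambda>x. \<phi> x * g x) = 0"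
    and y: "y \<in> box 0 (\<chi> i. 2 * pi)"
  shows "g y \<le> 0"
proof (rule ccontr)
  assume "\<not> g y \<le> 0"
  then have pos: "0 < g y" by simp
  define d where "d = real CARD('d)"
  define h :: "real^'d \<Rightarrow> real" where "h x = d + (\<Sum>i\<in>UNIV. cos (x $ i - y $ i))" for x
  have ch: "continuous_on S h" for S unfolding h_def by (intro continuous_intros)
  have cell: "compact (torus_cell :: (real^'d) set)" by (simp add: torus_cell_def)
  have h_y: "h y = 2 * d" by (simp add: h_def d_def)
  have d: "0 < d" by (simp add: d_def)
  have h_nonneg: "0 \<le> h x" for x
  proof -
    have "(\<Sum>i\<in>(UNIV::'d set). - 1) \<le> (\<Sum>i\<in>UNIV. cos (x $ i - y $ i))" by (intro sum_mono) auto
    then show ?thesis by (simp add: h_def d_def)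
  qed
  have h_less: "h x < 2 * d" if x: "x \<in> torus_cell" and "x \<noteq> y" for x
  proof -
    obtain i where i: "x $ i \<noteq> y $ i" using \<open>x \<noteq> y\<close> by (auto simp: vec_eq_iff)
    have "cos (x $ i - y $ i) \<noteq> 1"
    proof
      assume "cos (x $ i - y $ i) = 1"
      then obtain n :: int where n: "x $ i - y $ i = n * 2 * pi" by (auto simp: cos_one_2pi_int)
      have "\<bar>x $ i - y $ i\<bar> < 2 * pi"
        using x y by (auto simp: torus_cell_def mem_box_cart abs_less_iff intro: add_strict_increasing
            dest!: spec[of _ i])
      then have "\<bar>real_of_int n\<bar> < 1" unfolding n by (simp add: abs_mult)
      then have "n = 0" by linarith
      then show False using n i by simp
    qed
    then have lt: "cos (x $ i - y $ i) < 1" using cos_le_one[of "x $ i - y $ i"] by linarith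
    have "(\<Sum>i\<in>UNIV. cos (x $ i - y $ i)) < (\<Sum>i\<in>(UNIV::'d set). 1)"
      by (rule sum_strict_mono_ex1) (use lt in auto)
    then show ?thesis by (simp add: h_def d_def)
  qed
  define S where "S = {x \<in> torus_cell. g x \<le> g y / 2}"
  have "compact S"
  proof -
    have "closed {x. g x \<le> g y / 2}"
      by (rule closed_Collect_le) (auto intro: cont continuous_intros)
    then show ?thesis unfolding S_def using cell by (metis compact_Int_closed Collect_conj_eq Collect_mem_eq)
  qed
  obtain M where M: "0 \<le> M" "M < 2 * d" "\<And>x. x \<in> S \<Longrightarrow> h x \<le> M"
  proof (cases "S = {}")
    case True
    then show ?thesis using that[of 0] d by auto
  next
    case False
    then obtain z where z: "z \<in> S" "\<And>x. x \<in> S \<Longrightarrow> h x \<le> h z"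
      using continuous_attains_sup[OF \<open>compact S\<close> _ ch] by blast
    then have "z \<noteq> y" "z \<in> torus_cell" using pos by (auto simp: S_def)
    then show ?thesis using that[of "h z"] h_nonneg h_less z by blast
  qed
  \<comment> \<open>any level strictly between the bound on \<open>S\<close> and the maximum of \<open>h\<close>\<close>
  define M' where "M' = (M + 2 * d) / 2"
  have M': "M < M'" "M' < 2 * d" "0 < M'" using M d by (auto simp: M'_def)
  have "open ({x. M' < h x} \<inter> box 0 (\<chi> i. 2 * pi))"
    by (intro open_Int open_Collect_less continuous_intros ch) auto
  moreover have "y \<in> {x. M' < h x} \<inter> box 0 (\<chi> i. 2 * pi)" using y M' h_y by simp
  ultimately obtain a b where ab: "cbox a b \<subseteq> {x. M' < h x} \<inter> box 0 (\<chi> i. 2 * pi)" "y \<in> box a b"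
    using open_contains_cbox by (metis (no_types, lifting))
  have vol: "0 < measure lborel (cbox a b)"
    using ab(2) by (metis box_eq_empty(1) content_pos_lt_eq empty_iff not_le box_ne_empty(2))
  have sub: "cbox a b \<subseteq> torus_cell" using ab(1) box_subset_cbox by (fastforce simp: torus_cell_def)
  obtain G where G: "0 \<le> G" "\<And>x. x \<in> torus_cell \<Longrightarrow> \<bar>g x\<bar> \<le> G"
  proof -
    have "bounded (g ` torus_cell)"
      by (intro compact_imp_bounded compact_continuous_image cell continuous_on_subset[OF cont]) auto
    then obtain B where "0 < B" "\<forall>z\<in>g ` torus_cell. norm z \<le> B" unfolding bounded_pos by blast
    then show ?thesis by (intro that[of B]) auto
  qed
  have pointwise: "M' ^ n * (g y / 2) * (if x \<in> cbox a b then 1 else 0) - M ^ n * G \<le> h x ^ n * g x"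
    if x: "x \<in> torus_cell" for x n
  proof (cases "x \<in> S")
    case True
    then have "h x \<le> M" using M by blast
    then have "x \<notin> cbox a b" using ab(1) M' by auto
    have "\<bar>h x ^ n * g x\<bar> \<le> M ^ n * G"
      using \<open>h x \<le> M\<close> h_nonneg[of x] G(2)[OF x] G(1) M(1)
      by (auto simp: abs_mult intro!: mult_mono power_mono)
    then show ?thesis using \<open>x \<notin> cbox a b\<close> by simp
  next
    case False
    then have gx: "g y / 2 < g x" using x by (simp add: S_def)
    have MG: "0 \<le> M ^ n * G" using M(1) G(1) by simp
    show ?thesis
    proof (cases "x \<in> cbox a b")
      case True
      then have "M' ^ n * (g y / 2) \<le> h x ^ n * g x"
        using ab(1) M' gx pos by (intro mult_mono power_mono) auto
      then show ?thesis using True MG by simp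
    next
      case False
      have "0 \<le> h x ^ n * g x" using h_nonneg[of x] gx pos by simp
      then show ?thesis using False MG by simp
    qed
  qed
  have main: "M' ^ n * (g y / 2) * measure lborel (cbox a b) \<le> M ^ n * G * measure lborel (torus_cell :: (real^'d) set)" for n
  proof -
    have h_trig: "h \<in> trig_polynomials"
    proof -
      have "cos (x $ i - y $ i) = cos (wave_vector (axis i 1) \<bullet> x + (- y $ i))" for x :: "real^'d" and i
      proof -
        have "wave_vector (axis i 1) = axis i 1" by (auto simp: wave_vector_def vec_eq_iff axis_def)
        then show ?thesis by (simp add: inner_axis')
      qed
      then have "h = (\<lambda>x. d + (\<Sum>i\<in>UNIV. cos (wave_vector (axis i 1) \<bullet> x + (- y $ i))))"
        by (simp add: h_def fun_eq_iff)
      then show ?thesis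
        by (simp only:) (intro trig_polynomials.add trig_polynomials.const trig_polynomial_sum
            trig_polynomials.wave finite)
    qed
    have "((\<lambda>x. 1::real) has_integral measure lborel (cbox a b)) (cbox a b)"
      using has_integral_const[of "1::real" a b] by simp
    then have "((\<lambda>x. if x \<in> cbox a b then 1 else 0::real) has_integral measure lborel (cbox a b)) torus_cell"
      by (subst has_integral_restrict[OF sub])
    moreover have "((\<lambda>x :: real^'d. M ^ n * G) has_integral M ^ n * G * measure lborel (torus_cell :: (real^'d) set)) torus_cell"
      unfolding torus_cell_def
      using has_integral_const[of "M ^ n * G" 0 "(\<chi> i. 2 * pi) :: real^'d"] by (simp add: mult_ac)
    ultimately have lower: "((\<lambda>x. M' ^ n * (g y / 2) * (if x \<in> cbox a b then 1 else 0) - M ^ n * G) has_integral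
        M' ^ n * (g y / 2) * measure lborel (cbox a b) - M ^ n * G * measure lborel (torus_cell :: (real^'d) set)) torus_cell"
      by (intro has_integral_diff has_integral_mult_right)
    have "(\<lambda>x. h x ^ n * g x) integrable_on torus_cell"
      by (intro continuous_on_cell_integrable continuous_intros ch cont)
    moreover have "integral torus_cell (\<lambda>x. h x ^ n * g x) = 0"
      by (intro zero trig_polynomial_test trig_polynomial_power h_trig)
    ultimately have "((\<lambda>x. h x ^ n * g x) has_integral 0) torus_cell"
      by (metis integrable_integral)
    from has_integral_le[OF lower this] pointwise show ?thesis by fastforce
  qed
  define c where "c = g y / 2 * measure lborel (cbox a b)"
  define C where "C = G * measure lborel (torus_cell :: (real^'d) set)"
  have c: "0 < c" using pos vol by (simp add: c_def)
  have C: "0 \<le> C" using G by (simp add: C_def)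
  obtain n where n: "(M / M') ^ n < c / (C + 1)"
    using real_arch_pow_inv[of "c / (C + 1)" "M / M'"] c C M' M by auto
  then have "M ^ n * (C + 1) < M' ^ n * c"
    using M' C by (simp add: power_divide field_simps)
  moreover have "M' ^ n * c \<le> M ^ n * C" using main[of n] by (simp add: c_def C_def mult_ac)
  moreover have "M ^ n * C \<le> M ^ n * (C + 1)" using M(1) by (simp add: mult_left_mono)
  ultimately show False by linarith
qed

text \<open>On the interior, apply positivity detection to \<open>g\<close> and \<open>- g\<close>; the boundary of the cell
  follows by continuity.\<close>

lemma test_functions_separate:
  fixes g :: "real^'d \<Rightarrow> real"
  assumes cont: "continuous_on UNIV g"
    and zero: "\<And>\<phi>. \<phi> \<in> torus_test \<Longrightarrow> integral torus_cell (\<lambda>x. \<phi> x * g x) = 0"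
    and x: "x \<in> torus_cell"
  shows "g x = 0"
proof -
  have box: "g y = 0" if y: "y \<in> box 0 (\<chi> i. 2 * pi)" for y
  proof (rule antisym)
    show "g y \<le> 0" by (rule test_functions_detect_positivity[OF cont zero y])
    have "- g y \<le> 0"
      by (rule test_functions_detect_positivity[OF _ _ y]) (auto intro: continuous_intros cont simp: zero)
    then show "0 \<le> g y" by simp
  qed
  have "(\<chi> i. pi) \<in> box 0 ((\<chi> i. 2 * pi) :: real^'d)" by (simp add: mem_box_cart)
  then have "closure (box 0 ((\<chi> i. 2 * pi) :: real^'d)) = torus_cell"
    unfolding torus_cell_def by (intro closure_box) auto
  with x have "x \<in> closure (box 0 (\<chi> i. 2 * pi))" by simp
  then show ?thesis
    by (rule continuous_constant_on_closure[rotated 2]) (auto intro: continuous_on_subset[OF cont] box)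
qed

lemma regular_distribution_eq:
  assumes "continuous_on UNIV f" "\<phi> \<in> torus_test"
  shows "regular_distribution f \<phi> = integral torus_cell (\<lambda>x. \<phi> x *\<^sub>R f x)"
proof -
  have "set_integrable lborel torus_cell (\<lambda>x. \<phi> x *\<^sub>R f x)"
    unfolding set_integrable_def torus_cell_def
    by (intro borel_integrable_compact continuous_intros torus_testD(3)[OF assms(2)]
        continuous_on_subset[OF assms(1)]) auto
  then show ?thesis using assms(2)
    by (simp add: regular_distribution_def set_borel_integral_eq_integral(2))
qed

lemma regular_distribution_nth:
  assumes "continuous_on UNIV f" "\<phi> \<in> torus_test"
  shows "regular_distribution f \<phi> $ i = integral torus_cell (\<lambda>x. \<phi> x * f x $ i)"
  unfolding regular_distribution_eq[OF assms]
  by (subst integral_component_eq_cart[symmetric])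
     (auto intro!: continuous_on_cell_integrable continuous_intros torus_testD(3) assms)

lemma regular_distribution_inj:
  assumes f: "continuous_on UNIV f" and g: "continuous_on UNIV g"
    and eq: "regular_distribution f = regular_distribution g" and x: "x \<in> torus_cell"
  shows "f x = g x"
proof -
  have "f x $ i - g x $ i = 0" for i
  proof (rule test_functions_separate[OF _ _ x])
    show "continuous_on UNIV (\<lambda>x. f x $ i - g x $ i)" by (intro continuous_intros f g)
    fix \<phi> :: "real^'a \<Rightarrow> real" assume \<phi>: "\<phi> \<in> torus_test"
    have "integral torus_cell (\<lambda>x. \<phi> x * f x $ i) = integral torus_cell (\<lambda>x. \<phi> x * g x $ i)"
      using regular_distribution_nth[OF f \<phi>] regular_distribution_nth[OF g \<phi>] eq by metis
    then show "integral torus_cell (\<lambda>x. \<phi> x * (f x $ i - g x $ i)) = 0"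
      unfolding right_diff_distrib
      by (subst integral_diff)
         (auto intro!: continuous_on_cell_integrable continuous_intros torus_testD(3)[OF \<phi>] f g)
  qed
  then show ?thesis by (simp add: vec_eq_iff)
qed

lemma regular_distribution_cong:
  assumes "\<And>x. x \<in> torus_cell \<Longrightarrow> f x = g x"
  shows "regular_distribution f = regular_distribution g"
  unfolding regular_distribution_def using assms
  by (auto simp: fun_eq_iff intro!: set_lebesgue_integral_cong simp: torus_cell_def)

lemma regular_distribution_diff:
  assumes f: "continuous_on UNIV f" and g: "continuous_on UNIV g"
  shows "regular_distribution f - regular_distribution g = regular_distribution (\<lambda>x. f x - g x)"
proof
  fix \<phi> :: "real^'a \<Rightarrow> real"
  have fg: "continuous_on UNIV (\<lambda>x. f x - g x)" by (intro continuous_intros f g)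
  show "(regular_distribution f - regular_distribution g) \<phi> = regular_distribution (\<lambda>x. f x - g x) \<phi>"
  proof (cases "\<phi> \<in> torus_test")
    case True
    then show ?thesis
      by (simp add: regular_distribution_eq f g fg scaleR_diff_right)
         (subst integral_diff, auto intro!: continuous_on_cell_integrable continuous_intros
            torus_testD(3)[OF True] f g)
  qed (simp add: regular_distribution_def)
qed

text \<open>An estimate by the supremum of the test function suffices, so the order \<open>N\<close> in the definition
  of distributions is \<open>0\<close>.\<close>

lemma regular_distribution_in_distributions:
  fixes f :: "real^'d \<Rightarrow> real^'d"
  assumes f: "continuous_on UNIV f"
  shows "regular_distribution f \<in> torus_distributions"
proof -
  have int: "(\<lambda>x. \<phi> x *\<^sub>R f x) integrable_on torus_cell" if "\<phi> \<in> torus_test" for \<phi>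
    by (intro continuous_on_cell_integrable continuous_intros torus_testD(3)[OF that] f)
  have add: "(\<lambda>x. \<phi> x + \<psi> x) \<in> torus_test" if "\<phi> \<in> torus_test" "\<psi> \<in> torus_test"
    for \<phi> \<psi> :: "real^'d \<Rightarrow> real"
  proof -
    have d: "partials js \<phi> differentiable (at x)" "partials js \<psi> differentiable (at x)" for js x
      using that unfolding torus_test_def smooth_def by blast+
    have "partials js (\<lambda>x. \<phi> x + \<psi> x) = (\<lambda>x. partials js \<phi> x + partials js \<psi> x)" for js
      by (induction js) (auto simp: partial_add d)
    then have "smooth (\<lambda>x. \<phi> x + \<psi> x)" unfolding smooth_def by (auto simp: d)
    then show ?thesis using that by (auto simp: torus_test_def torus_periodic_def)
  qed
  have scale: "(\<lambda>x. a * \<phi> x) \<in> torus_test" if "\<phi> \<in> torus_test" for \<phi> :: "real^'d \<Rightarrow> real" and a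
  proof -
    have d: "partials js \<phi> differentiable (at x)" for js x
      using that unfolding torus_test_def smooth_def by blast
    have "partials js (\<lambda>x. a * \<phi> x) = (\<lambda>x. a * partials js \<phi> x)" for js
      by (induction js) (auto simp: partial_mult d)
    then have "smooth (\<lambda>x. a * \<phi> x)" unfolding smooth_def by (auto simp: d)
    then show ?thesis using that by (auto simp: torus_test_def torus_periodic_def)
  qed
  obtain L where L: "\<And>x. x \<in> torus_cell \<Longrightarrow> norm (f x) \<le> L"
  proof -
    have "bounded (f ` torus_cell)" unfolding torus_cell_def
      by (intro compact_imp_bounded compact_continuous_image continuous_on_subset[OF f]) auto
    then show ?thesis using that by (auto simp: bounded_iff)
  qed
  have bound: "norm (regular_distribution f \<phi>) \<le> (L * measure lborel (torus_cell :: (real^'d) set)) * M"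
    if \<phi>: "\<phi> \<in> torus_test" and M: "\<And>js x. length js \<le> 0 \<Longrightarrow> \<bar>partials js \<phi> x\<bar> \<le> M" for \<phi> M
  proof -
    have M: "\<bar>\<phi> x\<bar> \<le> M" for x using M[of "[]" x] by simp
    have "norm (\<phi> x *\<^sub>R f x) \<le> M * L" if "x \<in> torus_cell" for x
      using mult_mono[OF M L[OF that]] M[of x] by (simp add: order_trans[OF abs_ge_zero])
    moreover have "0 \<le> M * L"
    proof -
      have "0 \<in> (torus_cell :: (real^'d) set)" by (simp add: torus_cell_def mem_box_cart)
      from L[OF this] have "0 \<le> L" using norm_ge_zero order_trans by blast
      then show ?thesis using M[of 0] by (simp add: order_trans[OF abs_ge_zero])
    qed
    ultimately have "norm (integral torus_cell (\<lambda>x. \<phi> x *\<^sub>R f x)) \<le> M * L * measure lborel (torus_cell :: (real^'d) set)"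
      using int[OF \<phi>] unfolding torus_cell_def
      by (intro has_integral_bound[where f = "\<lambda>x. \<phi> x *\<^sub>R f x"]) auto
    then show ?thesis using regular_distribution_eq[OF f \<phi>] by (simp add: mult_ac)
  qed
  show ?thesis
    unfolding torus_distributions_def mem_Collect_eq
  proof (intro conjI ballI allI impI)
    fix \<phi> \<psi> :: "real^'d \<Rightarrow> real" and a :: real
    assume t: "\<phi> \<in> torus_test"
    show "regular_distribution f (\<lambda>x. a * \<phi> x) = a *\<^sub>R regular_distribution f \<phi>"
      unfolding regular_distribution_eq[OF f t] regular_distribution_eq[OF f scale[OF t]]
      by (simp flip: scaleR_scaleR)
    assume t': "\<psi> \<in> torus_test"
    show "regular_distribution f (\<lambda>x. \<phi> x + \<psi> x) = regular_distribution f \<phi> + regular_distribution f \<psi>"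
      by (simp add: regular_distribution_eq f t t' add scaleR_add_left int integral_add)
  next
    show "\<exists>C N. \<forall>\<phi>\<in>torus_test. \<forall>M. (\<forall>js x. length js \<le> N \<longrightarrow> \<bar>partials js \<phi> x\<bar> \<le> M) \<longrightarrow>
        norm (regular_distribution f \<phi>) \<le> C * M"
      using bound by blast
  qed (simp add: regular_distribution_def)
qed

lemma regular_distribution_divergence_free:
  fixes f :: "real^'d \<Rightarrow> real^'d"
  assumes f: "\<And>x. f differentiable (at x)" "torus_periodic f" "\<And>i. continuous_on UNIV (partial i f)"
    and div: "\<And>x. (\<Sum>i\<in>UNIV. partial i f x $ i) = 0"
  shows "divergence_free (regular_distribution f)"
  unfolding divergence_free_def
proof
  fix \<phi> :: "real^'d \<Rightarrow> real" assume \<phi>: "\<phi> \<in> torus_test"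
  have cf: "continuous_on UNIV f" using f(1) by (rule differentiable_imp_continuous_on)
  have eq: "partial i (\<lambda>x. f x $ i) = (\<lambda>x. partial i f x $ i)" for i
    using partial_nth[OF f(1)] by blast
  have "regular_distribution f (partial i \<phi>) $ i = - integral torus_cell (\<lambda>x. \<phi> x * partial i f x $ i)" for i
  proof -
    have "integral torus_cell (\<lambda>x. \<phi> x * partial i (\<lambda>x. f x $ i) x)
        = - integral torus_cell (\<lambda>x. partial i \<phi> x * f x $ i)"
    proof (rule integral_by_parts_periodic)
      show "continuous_on UNIV (partial i (\<lambda>x. f x $ i))" unfolding eq by (intro continuous_intros f)
      show "torus_periodic (\<lambda>x. f x $ i)" using f(2) by (simp add: torus_periodic_def)
    qed (use torus_testD[OF \<phi>] torus_testD(3)[OF torus_testD(4)[OF \<phi>]] f(1) in \<open>auto intro: differentiable_nth\<close>)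
    then show ?thesis unfolding regular_distribution_nth[OF cf torus_testD(4)[OF \<phi>]] eq by simp
  qed
  then have "(\<Sum>i\<in>UNIV. regular_distribution f (partial i \<phi>) $ i)
      = - (\<Sum>i\<in>UNIV. integral torus_cell (\<lambda>x. \<phi> x * partial i f x $ i))"
    by (simp add: sum_negf)
  also have "\<dots> = - integral torus_cell (\<lambda>x. \<Sum>i\<in>UNIV. \<phi> x * partial i f x $ i)"
    by (subst integral_sum)
       (auto intro!: continuous_on_cell_integrable continuous_intros torus_testD(3)[OF \<phi>] f)
  also have "\<dots> = 0" by (simp flip: sum_distrib_left add: div)
  finally show "(\<Sum>i\<in>UNIV. regular_distribution f (partial i \<phi>) $ i) = 0" .
qed

section \<open>Fourier coefficients and Littlewood-Paley blocks of shear waves\<close>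

text \<open>A mean velocity \<open>a\<close> along \<open>x\<^sub>i\<close> together with a plane wave of frequency \<open>n\<close>, amplitude \<open>b\<close>
  and phase \<open>\<theta>\<close>, which points along \<open>x\<^sub>j\<close> and depends on \<open>x\<^sub>i\<close> alone.\<close>

definition shear :: "'d::finite \<Rightarrow> 'd \<Rightarrow> real \<Rightarrow> real \<Rightarrow> nat \<Rightarrow> real \<Rightarrow> real^'d \<Rightarrow> real^'d" where
  "shear i j a b n \<theta> x = a *\<^sub>R axis i 1 + (b * cos (real n * x $ i - \<theta>)) *\<^sub>R axis j 1"

lemma content_torus_cell: "measure lborel (torus_cell :: (real^'d) set) = (2 * pi) ^ CARD('d)"
proof -
  have "(\<chi> i. pi) \<in> cbox 0 ((\<chi> i. 2 * pi) :: real^'d)" by (simp add: mem_box_cart)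
  then have "cbox 0 ((\<chi> i. 2 * pi) :: real^'d) \<noteq> {}" by blast
  then show ?thesis by (simp add: torus_cell_def content_cbox_cart)
qed

lemma cell_volume_ge: "4 \<le> (2 * pi) ^ CARD('d::finite)"
proof -
  have "2 * pi \<le> (2 * pi) ^ CARD('d)"
    using pi_gt3 by (intro self_le_power) auto
  then show ?thesis using pi_gt3 by linarith
qed

text \<open>For \<open>k \<noteq> 0\<close> the wave is a multiple of a partial derivative of a periodic function.\<close>

lemma integral_wave:
  fixes k :: "int^'d"
  shows "integral torus_cell (\<lambda>x. cos (wave_vector k \<bullet> x + \<theta>))
    = (if k = 0 then (2 * pi) ^ CARD('d) * cos \<theta> else 0)"
proof (cases "k = 0")
  case True
  then have "wave_vector k = 0" by (simp add: wave_vector_def vec_eq_iff)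
  then show ?thesis using True content_torus_cell[where 'd = 'd] by (simp add: torus_cell_def)
next
  case False
  then obtain i where "k $ i \<noteq> 0" by (auto simp: vec_eq_iff)
  then have ki: "wave_vector k $ i \<noteq> 0" by (simp add: wave_vector_def)
  define g where "g x = cos (wave_vector k \<bullet> x + (\<theta> - pi / 2))" for x
  have g: "g \<in> trig_polynomials" unfolding g_def by (rule trig_polynomials.wave)
  have eq: "partial i g = (\<lambda>x. wave_vector k $ i * cos (wave_vector k \<bullet> x + \<theta>))"
    unfolding g_def using partial_wave[of i "wave_vector k" "\<theta> - pi / 2"] by auto
  have "integral torus_cell (partial i g) = 0"
    using torus_testD[OF trig_polynomial_test[OF g]] torus_testD(3)[OF torus_testD(4)[OF trig_polynomial_test[OF g]]]
    by (intro integral_partial_periodic) (auto simp: torus_periodic_def)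
  then show ?thesis unfolding eq using ki False by simp
qed

lemma wave_vector_axis: "wave_vector (axis i c) \<bullet> x = of_int c * x $ i"
proof -
  have "wave_vector (axis i c) = axis i (of_int c)" by (auto simp: wave_vector_def vec_eq_iff axis_def)
  then show ?thesis by (simp add: inner_axis')
qed

lemma norm_wave_vector_axis: "norm (wave_vector (axis i c)) = \<bar>of_int c\<bar>"
proof -
  have "wave_vector (axis i c) = of_int c *\<^sub>R axis i 1" by (auto simp: wave_vector_def vec_eq_iff axis_def)
  then show ?thesis by simp
qed

lemma wave_vector_add: "wave_vector (k + l) = wave_vector k + wave_vector l"
  by (simp add: wave_vector_def vec_eq_iff)

lemma wave_vector_minus: "wave_vector (- k) = - wave_vector k"
  by (simp add: wave_vector_def vec_eq_iff)

lemma integral_wave_mult: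
  fixes k :: "int^'d" and n :: nat and i :: 'd
  defines "N \<equiv> axis i (int n)"
  shows "integral torus_cell (\<lambda>x. cos (wave_vector k \<bullet> x + \<phi>) * cos (real n * x $ i - \<theta>))
    = (2 * pi) ^ CARD('d) / 2
      * ((if k = - N then cos (\<phi> - \<theta>) else 0) + (if k = N then cos (\<phi> + \<theta>) else 0))"
proof -
  have "cos (wave_vector k \<bullet> x + \<phi>) * cos (real n * x $ i - \<theta>)
      = 1/2 * cos (wave_vector (k + N) \<bullet> x + (\<phi> - \<theta>)) + 1/2 * cos (wave_vector (k + (- N)) \<bullet> x + (\<phi> + \<theta>))" for x
    unfolding cos_times_cos wave_vector_add wave_vector_minus inner_add_left inner_minus_left N_def wave_vector_axis
    by (simp add: algebra_simps)
  then have "integral torus_cell (\<lambda>x. cos (wave_vector k \<bullet> x + \<phi>) * cos (real n * x $ i - \<theta>))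
      = 1/2 * integral torus_cell (\<lambda>x. cos (wave_vector (k + N) \<bullet> x + (\<phi> - \<theta>)))
       + 1/2 * integral torus_cell (\<lambda>x. cos (wave_vector (k + (- N)) \<bullet> x + (\<phi> + \<theta>)))"
    by (simp only:) (subst integral_add;
      auto intro!: continuous_on_cell_integrable continuous_intros)
  then show ?thesis unfolding integral_wave
    by (auto simp: add_eq_0_iff2 algebra_simps add_divide_distrib)
qed

lemma shear_nth: "i \<noteq> j \<Longrightarrow> shear i j a b n \<theta> x $ l =
    (if l = i then a else 0) + (if l = j then b * cos (real n * x $ i - \<theta>) else 0)"
  by (auto simp: shear_def axis_def)

lemma continuous_on_shear: "continuous_on S (shear i j a b n \<theta>)"
  unfolding shear_def[abs_def] by (intro continuous_intros)

text \<open>With a free phase \<open>\<phi>\<close> this covers both trigonometric functions in the definition of Fourier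
  coefficients: the sine is the cosine with \<open>\<phi> = - pi / 2\<close>.\<close>

lemma shear_against_wave:
  fixes k :: "int^'d" and n :: nat and i :: 'd
  assumes "i \<noteq> j"
  defines "N \<equiv> axis i (int n)"
  shows "regular_distribution (shear i j a b n \<theta>) (\<lambda>x. cos (wave_vector k \<bullet> x + \<phi>)) $ l
    = (2 * pi) ^ CARD('d) * ((if l = i \<and> k = 0 then a * cos \<phi> else 0)
      + (if l = j then b / 2 * ((if k = - N then cos (\<phi> - \<theta>) else 0) + (if k = N then cos (\<phi> + \<theta>) else 0)) else 0))"
proof -
  have "regular_distribution (shear i j a b n \<theta>) (\<lambda>x. cos (wave_vector k \<bullet> x + \<phi>)) $ l
     = integral torus_cell (\<lambda>x. cos (wave_vector k \<bullet> x + \<phi>) * shear i j a b n \<theta> x $ l)"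
    by (intro regular_distribution_nth continuous_on_shear trig_polynomial_test trig_polynomials.wave)
  also have "\<dots> = integral torus_cell (\<lambda>x. (if l = i then a else 0) * cos (wave_vector k \<bullet> x + \<phi>)
      + (if l = j then b else 0) * (cos (wave_vector k \<bullet> x + \<phi>) * cos (real n * x $ i - \<theta>)))"
    by (intro integral_cong) (auto simp: shear_nth[OF assms(1)] algebra_simps)
  also have "\<dots> = (if l = i then a else 0) * integral torus_cell (\<lambda>x. cos (wave_vector k \<bullet> x + \<phi>))
      + (if l = j then b else 0) *
        integral torus_cell (\<lambda>x. cos (wave_vector k \<bullet> x + \<phi>) * cos (real n * x $ i - \<theta>))"
    by (subst integral_add)
       (auto intro!: continuous_on_cell_integrable continuous_intros)
  finally show ?thesis unfolding integral_wave integral_wave_mult N_def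
    by (simp add: algebra_simps)
qed

lemma lp_symbol_eq_0:
  assumes "bump_function \<phi>\<^sub>0" "2 ^ (r + 1) \<le> norm \<xi>"
  shows "lp_symbol \<phi>\<^sub>0 r \<xi> = 0"
proof (cases r)
  case 0
  then show ?thesis using assms by (simp add: lp_symbol_def bump_function_def)
next
  case (Suc r')
  have "norm (\<xi> /\<^sub>R 2 ^ r') = norm \<xi> / 2 ^ r'" by (simp add: divide_inverse mult.commute)
  then have "4 \<le> norm (\<xi> /\<^sub>R 2 ^ r')" using assms(2) by (simp add: Suc le_divide_eq)
  then show ?thesis using assms(1) Suc
    by (simp add: lp_symbol_def bump_function_def Let_def)
qed

text \<open>A Littlewood-Paley block is a sum over this set, and a sum over an infinite set would be zero by
  convention.\<close>

lemma finite_lp_support: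
  fixes \<phi>\<^sub>0 :: "real^'d \<Rightarrow> real"
  assumes "bump_function \<phi>\<^sub>0"
  shows "finite {k. lp_symbol \<phi>\<^sub>0 r (wave_vector k) \<noteq> 0}"
proof -
  define R where "R = (2::int) ^ (r + 1)"
  have "\<bar>k $ i\<bar> \<le> R" if "lp_symbol \<phi>\<^sub>0 r (wave_vector k) \<noteq> 0" for k i
  proof -
    have "norm (wave_vector k) < 2 ^ (r + 1)" using lp_symbol_eq_0[OF assms, of r "wave_vector k"] that by linarith
    then have "\<bar>wave_vector k $ i\<bar> < 2 ^ (r + 1)"
      using component_le_norm_cart[of "wave_vector k" i] by linarith
    then have "real_of_int \<bar>k $ i\<bar> < real_of_int R" by (simp add: wave_vector_def R_def)
    then show ?thesis by (simp only: of_int_less_iff less_imp_le)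
  qed
  then have bound: "vec_nth k \<in> PiE UNIV (\<lambda>_. {- R..R})" if "lp_symbol \<phi>\<^sub>0 r (wave_vector k) \<noteq> 0" for k
    using that by (auto simp: abs_le_iff minus_le_iff)
  have "{k. lp_symbol \<phi>\<^sub>0 r (wave_vector k) \<noteq> 0} \<subseteq> vec_lambda ` (PiE UNIV (\<lambda>_. {- R..R}))"
  proof
    fix k assume "k \<in> {k. lp_symbol \<phi>\<^sub>0 r (wave_vector k) \<noteq> 0}"
    then have "vec_nth k \<in> PiE UNIV (\<lambda>_. {- R..R})" using bound by blast
    then show "k \<in> vec_lambda ` (PiE UNIV (\<lambda>_. {- R..R}))"
      by (rule rev_image_eqI) (simp add: vec_nth_inverse)
  qed
  then show ?thesis by (rule finite_subset) (intro finite_imageI finite_PiE; simp)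
qed

lemma lp_symbol_zero:
  assumes "bump_function \<phi>\<^sub>0"
  shows "lp_symbol \<phi>\<^sub>0 r 0 = (if r = 0 then 1 else 0)"
  using assms by (simp add: lp_symbol_def bump_function_def)

text \<open>On a dyadic sphere the bump function is only evaluated at points of norm at most \<open>1\<close> or at
  least \<open>2\<close>, where its values are prescribed. This is why frequencies \<open>2\<^sup>m\<close> are used.\<close>

lemma lp_symbol_dyadic:
  assumes "bump_function \<phi>\<^sub>0" "norm \<xi> = 2 ^ m" "0 < m"
  shows "lp_symbol \<phi>\<^sub>0 r \<xi> = (if r = m then 1 else 0)"
proof -
  have one: "\<phi>\<^sub>0 \<eta> = 1" if "norm \<eta> \<le> 1" for \<eta> using assms(1) that by (simp add: bump_function_def)
  have zero: "\<phi>\<^sub>0 \<eta> = 0" if "2 \<le> norm \<eta>" for \<eta> using assms(1) that by (simp add: bump_function_def)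
  have scale: "norm (\<xi> /\<^sub>R 2 ^ l) = 2 ^ m / 2 ^ l" for l using assms(2) by (simp add: divide_inverse mult.commute)
  consider "r < m" | "r = m" | "m < r" by linarith
  then show ?thesis
  proof cases
    case 1
    then have "(2::real) ^ (r + 1) \<le> norm \<xi>" unfolding assms(2) by (intro power_increasing) auto
    then show ?thesis using lp_symbol_eq_0[OF assms(1)] 1 by simp
  next
    case 2
    then obtain r' where r: "m = Suc r'" using assms(3) gr0_conv_Suc by blast
    then have "norm (\<xi> /\<^sub>R 2 ^ r') = 2" using scale[of r'] by simp
    then show ?thesis using 2 r one[of "(\<xi> /\<^sub>R 2 ^ r') /\<^sub>R 2"] zero[of "\<xi> /\<^sub>R 2 ^ r'"]
      by (simp add: lp_symbol_def Let_def)
  next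
    case 3
    then obtain r' where r: "r = Suc r'" "m \<le> r'" by (cases r) auto
    then have "norm (\<xi> /\<^sub>R 2 ^ r') \<le> 1" using scale[of r'] power_increasing[of m r' "2::real"] by simp
    then show ?thesis using 3 r one[of "(\<xi> /\<^sub>R 2 ^ r') /\<^sub>R 2"] one[of "\<xi> /\<^sub>R 2 ^ r'"]
      by (simp add: lp_symbol_def Let_def)
  qed
qed

lemma fourier_coeff_shear:
  fixes k :: "int^'d" and n :: nat and i :: 'd
  assumes "i \<noteq> j" and n: "0 < n"
  defines "N \<equiv> axis i (int n)"
  shows "fourier_coeff (regular_distribution (shear i j a b n \<theta>)) k $ l
    = (if k = 0 then (if l = i then of_real a else 0) else 0)
      + ((if k = N then (if l = j then of_real (b / 2) * cis (- \<theta>) else 0) else 0)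
      + (if k = - N then (if l = j then of_real (b / 2) * cis \<theta> else 0) else 0))"
proof -
  \<comment> \<open>a positive \<open>n\<close> keeps the three frequencies \<open>0\<close>, \<open>N\<close> and \<open>- N\<close> apart\<close>
  have "N $ i \<noteq> 0" "N $ i \<noteq> (- N) $ i" using n by (simp_all add: N_def)
  then have N: "N \<noteq> 0" "N \<noteq> - N" by fastforce+
  have sin: "sin y = cos (y + (- (pi / 2)))" for y :: real
    unfolding cos_add by simp
  have c1: "cos (- (pi / 2) - \<theta>) = - sin \<theta>" and c2: "cos (- (pi / 2) + \<theta>) = sin \<theta>"
    unfolding cos_add cos_diff by simp_all
  define V where "V = (2 * pi) ^ CARD('d)"
  have V: "V \<noteq> 0" by (simp add: V_def)
  define C where "C = (if l = i \<and> k = 0 then a else 0)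
    + (if l = j then b / 2 * ((if k = - N then cos \<theta> else 0) + (if k = N then cos \<theta> else 0)) else 0)"
  define D where "D = (if l = j then b / 2 * ((if k = - N then - sin \<theta> else 0) + (if k = N then sin \<theta> else 0)) else 0)"
  have "regular_distribution (shear i j a b n \<theta>) (\<lambda>x. cos (wave_vector k \<bullet> x)) $ l = V * C"
    using shear_against_wave[OF assms(1), of a b n \<theta> k 0 l]
    unfolding V_def C_def N_def
    by (simp only: add_0_right add_0_left diff_0 cos_minus cos_zero mult_1_right)
  moreover have "regular_distribution (shear i j a b n \<theta>) (\<lambda>x. sin (wave_vector k \<bullet> x)) $ l = V * D"
  proof -
    have "(\<lambda>x. sin (wave_vector k \<bullet> x)) = (\<lambda>x. cos (wave_vector k \<bullet> x + (- (pi / 2))))"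
      using sin by blast
    then show ?thesis
      using shear_against_wave[OF assms(1), of a b n \<theta> k "- (pi / 2)" l]
      unfolding V_def D_def N_def c1 c2 by (simp only: cos_minus cos_pi_half mult_zero_right if_cancel add_0)
  qed
  ultimately have "fourier_coeff (regular_distribution (shear i j a b n \<theta>)) k $ l
      = Complex (V * C) (- (V * D)) / complex_of_real V"
    by (simp add: fourier_coeff_def V_def)
  also have "\<dots> = Complex C (- D)"
    using V by (simp add: complex_eq_iff)
  finally have coeff: "fourier_coeff (regular_distribution (shear i j a b n \<theta>)) k $ l = Complex C (- D)" .
  consider "k = 0" | "k = N" "k \<noteq> 0" "k \<noteq> - N" | "k = - N" "k \<noteq> 0" "k \<noteq> N" | "k \<noteq> 0" "k \<noteq> N" "k \<noteq> - N"
    using N by fastforce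
  then show ?thesis
  proof cases
    case 1
    then have "k \<noteq> N" "k \<noteq> - N" using N by fastforce+
    with 1 show ?thesis unfolding coeff C_def D_def by (simp add: complex_eq_iff)
  qed (unfold coeff C_def D_def, simp_all add: complex_eq_iff)
qed

lemma wave_vector_0: "wave_vector 0 = 0"
  by (simp add: wave_vector_def vec_eq_iff)

lemma lp_block_shear:
  fixes \<phi>\<^sub>0 :: "real^'d \<Rightarrow> real"
  assumes "bump_function \<phi>\<^sub>0" "i \<noteq> j" "0 < m"
  shows "lp_block \<phi>\<^sub>0 r (regular_distribution (shear i j a b (2 ^ m) \<theta>)) x
    = (if r = 0 then axis i (of_real a) else 0)
      + (if r = m then axis j (of_real (b * cos (real (2 ^ m) * x $ i - \<theta>))) else 0)"
proof -
  define F where "F = regular_distribution (shear i j a b (2 ^ m) \<theta>)"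
  define N where "N = axis i (int (2 ^ m))"
  define S where "S = {k :: int^'d. lp_symbol \<phi>\<^sub>0 r (wave_vector k) \<noteq> 0}"
  define sym where "sym k = lp_symbol \<phi>\<^sub>0 r (wave_vector k)" for k :: "int^'d"
  \<comment> \<open>a frequency \<open>k0\<close> outside \<open>S\<close> is no exception, because its symbol is zero\<close>
  have pick: "(\<Sum>k\<in>S. of_real (sym k) * (if k = k0 then c else 0) * cis (wave_vector k \<bullet> x))
      = of_real (sym k0) * c * cis (wave_vector k0 \<bullet> x)" for k0 and c :: complex
  proof -
    have "(\<Sum>k\<in>S. of_real (sym k) * (if k = k0 then c else 0) * cis (wave_vector k \<bullet> x))
       = (\<Sum>k\<in>S. if k = k0 then of_real (sym k) * c * cis (wave_vector k \<bullet> x) else 0)"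
      by (rule sum.cong) auto
    also have "\<dots> = (if k0 \<in> S then of_real (sym k0) * c * cis (wave_vector k0 \<bullet> x) else 0)"
      using finite_lp_support[OF assms(1), of r] by (simp add: S_def)
    finally show ?thesis by (simp add: S_def sym_def)
  qed
  have sym0: "sym 0 = (if r = 0 then 1 else 0)"
    unfolding sym_def wave_vector_0 by (rule lp_symbol_zero[OF assms(1)])
  have symN: "sym N = (if r = m then 1 else 0)" "sym (- N) = (if r = m then 1 else 0)"
    unfolding sym_def by (rule lp_symbol_dyadic[OF assms(1) _ assms(3)];
      simp add: N_def norm_wave_vector_axis wave_vector_minus)+
  have Nx: "wave_vector N \<bullet> x = real (2 ^ m) * x $ i" by (simp add: N_def wave_vector_axis)
  have coeff: "fourier_coeff F k $ l = (if k = 0 then (if l = i then of_real a else 0) else 0)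
      + ((if k = N then (if l = j then of_real (b / 2) * cis (- \<theta>) else 0) else 0)
      + (if k = - N then (if l = j then of_real (b / 2) * cis \<theta> else 0) else 0))" for k l
    unfolding F_def N_def by (rule fourier_coeff_shear[OF assms(2)]) simp
  have block: "lp_block \<phi>\<^sub>0 r F x $ l
    = of_real (sym 0) * (if l = i then of_real a else 0) * cis (wave_vector 0 \<bullet> x)
      + (of_real (sym N) * (if l = j then of_real (b / 2) * cis (- \<theta>) else 0) * cis (wave_vector N \<bullet> x)
      + of_real (sym (- N)) * (if l = j then of_real (b / 2) * cis \<theta> else 0) * cis (wave_vector (- N) \<bullet> x))" for l
  proof -
    have "lp_block \<phi>\<^sub>0 r F x $ l = (\<Sum>k\<in>S. of_real (sym k) * fourier_coeff F k $ l * cis (wave_vector k \<bullet> x))"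
      by (simp add: lp_block_def S_def sym_def)
    also have "\<dots> = (\<Sum>k\<in>S. of_real (sym k) * (if k = 0 then (if l = i then of_real a else 0) else 0) * cis (wave_vector k \<bullet> x))
      + ((\<Sum>k\<in>S. of_real (sym k) * (if k = N then (if l = j then of_real (b / 2) * cis (- \<theta>) else 0) else 0) * cis (wave_vector k \<bullet> x))
      + (\<Sum>k\<in>S. of_real (sym k) * (if k = - N then (if l = j then of_real (b / 2) * cis \<theta> else 0) else 0) * cis (wave_vector k \<bullet> x)))"
      unfolding sum.distrib[symmetric] coeff by (simp only: distrib_left distrib_right)
    finally show ?thesis unfolding pick .
  qed
  have "of_real (b / 2) * cis (- \<theta>) * cis (real (2 ^ m) * x $ i) + of_real (b / 2) * cis \<theta> * cis (- (real (2 ^ m) * x $ i))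
      = complex_of_real (b * cos (real (2 ^ m) * x $ i - \<theta>))"
    unfolding cos_diff complex_eq_iff by (simp add: field_simps)
  with assms(3) show ?thesis
    unfolding vec_eq_iff F_def[symmetric] block symN sym0 wave_vector_minus inner_minus_left Nx
    by (auto simp: axis_def wave_vector_0 mult.assoc)
qed

section \<open>Lebesgue and Besov norms of shear waves\<close>

lemma ennreal_powr_ennreal: "0 \<le> z \<Longrightarrow> ennreal_powr (ennreal z) r = ennreal (z powr r)"
  by (simp add: ennreal_powr_def)

lemma ennreal_powr_mono:
  assumes "x \<le> y" "0 \<le> r"
  shows "ennreal_powr x r \<le> ennreal_powr y r"
proof (cases "y = \<infinity>")
  case False
  then have "x \<noteq> \<infinity>" using assms(1) by (auto simp: top_unique)
  with False assms show ?thesis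
    unfolding ennreal_powr_def
    by (auto intro!: ennreal_leI powr_mono2 enn2real_mono simp: less_top)
qed (simp add: ennreal_powr_def)

lemma emeasure_torus_cell: "emeasure lborel (torus_cell :: (real^'d) set) = ennreal ((2 * pi) ^ CARD('d))"
proof -
  have "emeasure lborel (torus_cell :: (real^'d) set) < top"
    unfolding torus_cell_def using emeasure_lborel_cbox_finite by simp
  then have "emeasure lborel (torus_cell :: (real^'d) set) \<noteq> top" by simp
  then show ?thesis using emeasure_eq_ennreal_measure content_torus_cell[where 'd = 'd] by metis
qed

lemma torus_cell_borel [measurable]: "(torus_cell :: (real^'d) set) \<in> sets borel"
  by (simp add: torus_cell_def)

text \<open>The cell has volume at least \<open>1\<close>, so the volume to the power \<open>1/p\<close> is bounded by the volume. This
  gives one constant for all \<open>p\<close>.\<close>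

lemma torus_Lp_norm_le:
  fixes f :: "real^'d \<Rightarrow> 'b::real_normed_vector"
  assumes p: "1 \<le> p" and cont: "continuous_on UNIV f" and B: "\<And>x. norm (f x) \<le> B"
  shows "torus_Lp_norm p f \<le> ennreal ((2 * pi) ^ CARD('d) * B)"
proof -
  define K where "K = (2 * pi) ^ CARD('d)"
  have K: "1 \<le> K" using cell_volume_ge[where 'd = 'd] by (simp add: K_def)
  have emK: "emeasure lborel (torus_cell :: (real^'d) set) = ennreal K"
    unfolding K_def by (rule emeasure_torus_cell)
  have B0: "0 \<le> B" using B[of 0] norm_ge_zero order_trans by blast
  show ?thesis
  proof (cases "p = \<infinity>")
    case True
    have "(\<lambda>x. ennreal (norm (f x))) \<in> borel_measurable (restrict_space lborel torus_cell)"
      by (intro measurable_restrict_space1 measurable_compose[OF _ measurable_ennreal])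
         (simp add: borel_measurable_continuous_onI cont continuous_on_norm)
    then have "esssup (restrict_space lborel torus_cell) (\<lambda>x. ennreal (norm (f x))) \<le> ennreal B"
      by (intro esssup_I) (auto intro!: ennreal_leI B)
    also have "ennreal B \<le> ennreal (K * B)"
      using mult_right_mono[OF K B0] by (intro ennreal_leI) simp
    finally show ?thesis using True by (simp add: torus_Lp_norm_def K_def)
  next
    case False
    then obtain r where r: "p = ereal r" "1 \<le> r"
      using p by (cases p) (auto simp: one_ereal_def)
    have "(\<integral>\<^sup>+x\<in>torus_cell. ennreal (norm (f x) powr r) \<partial>lborel)
        \<le> (\<integral>\<^sup>+x\<in>(torus_cell :: (real^'d) set). ennreal (B powr r) \<partial>lborel)"
      using r B by (intro nn_integral_mono mult_right_mono ennreal_leI powr_mono2) auto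
    also have "\<dots> = ennreal (B powr r * K)"
      by (subst nn_integral_cmult_indicator)
         (use K in \<open>simp_all add: emK ennreal_mult torus_cell_borel\<close>)
    finally have "torus_Lp_norm p f \<le> ennreal_powr (ennreal (B powr r * K)) (1 / r)"
      unfolding torus_Lp_norm_def using r by (auto intro!: ennreal_powr_mono)
    also have "\<dots> = ennreal ((B powr r * K) powr (1 / r))"
      using K by (intro ennreal_powr_ennreal) auto
    also have "(B powr r * K) powr (1 / r) = B * K powr (1 / r)"
      using K B0 r by (simp add: powr_mult powr_powr)
    also have "\<dots> \<le> K * B"
      using powr_mono[of "1 / r" 1 K] K r B0 by (simp add: mult.commute mult_left_mono)
    finally show ?thesis by (simp add: K_def ennreal_leI)
  qed
qed

text \<open>The bound does not depend on \<open>n\<close> or \<open>p\<close>. It comes from the mean value \<open>1/2\<close> of \<open>cos\<^sup>2\<close>: since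
  \<open>cos\<^sup>2 \<le> 1/4 + (2 |cos|)\<^sup>p\<close> pointwise, the integral of \<open>(2 |cos|)\<^sup>p\<close> is at least a quarter of the volume of
  the cell, which exceeds \<open>1\<close>. For \<open>p = \<infinity>\<close>, if \<open>|cos| \<le> 1/2\<close> held almost everywhere, then the mean
  value would be at most \<open>1/4\<close>.\<close>

lemma torus_Lp_norm_cos_ge:
  fixes f :: "real^'d \<Rightarrow> 'b::real_normed_vector"
  assumes p: "1 \<le> p" and B0: "0 \<le> B" and n: "0 < n"
    and f: "\<And>x. norm (f x) = B * \<bar>cos (real n * x $ i - \<theta>)\<bar>"
  shows "ennreal (B / 2) \<le> torus_Lp_norm p f"
proof -
  define K where "K = (2 * pi) ^ CARD('d)"
  have K: "4 \<le> K" using cell_volume_ge[where 'd = 'd] by (simp add: K_def)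
  have emK: "emeasure lborel (torus_cell :: (real^'d) set) = ennreal K"
    unfolding K_def by (rule emeasure_torus_cell)
  define c where "c x = cos (real n * x $ i - \<theta>)" for x :: "real^'d"
  have cc: "continuous_on UNIV c" unfolding c_def by (intro continuous_intros)
  have cm [measurable]: "c \<in> borel_measurable borel" using cc by (rule borel_measurable_continuous_onI)
  have half: "(\<integral>\<^sup>+x\<in>torus_cell. ennreal ((c x)\<^sup>2) \<partial>lborel) = ennreal (K / 2)"
  proof -
    define N where "N = axis i (int n)"
    have wc: "c x = cos (wave_vector N \<bullet> x + (- \<theta>))" for x
      by (simp add: c_def N_def wave_vector_axis)
    have "N $ i \<noteq> 0" "N $ i \<noteq> (- N) $ i" using n by (simp_all add: N_def)
    then have "N \<noteq> 0" "N \<noteq> - N" by fastforce+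
    then have "integral torus_cell (\<lambda>x. c x * c x) = K / 2"
      using integral_wave_mult[of N "- \<theta>" n i \<theta>] unfolding wc[symmetric]
      by (simp add: K_def N_def c_def[symmetric])
    moreover have si: "set_integrable lborel torus_cell (\<lambda>x. c x * c x)"
      unfolding set_integrable_def torus_cell_def
      by (intro borel_integrable_compact continuous_intros continuous_on_subset[OF cc]) auto
    ultimately have L: "(LINT x:torus_cell|lborel. c x * c x) = K / 2"
      by (simp only: set_borel_integral_eq_integral(2))
    then have L': "(LINT x|lborel. indicator torus_cell x * (c x * c x)) = K / 2"
      unfolding set_lebesgue_integral_def by simp
    have I: "integrable lborel (\<lambda>x. indicator torus_cell x * (c x * c x))"
      using si by (simp add: set_integrable_def)
    have "(\<integral>\<^sup>+x\<in>torus_cell. ennreal ((c x)\<^sup>2) \<partial>lborel)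
        = (\<integral>\<^sup>+x. ennreal (indicator torus_cell x * (c x * c x)) \<partial>lborel)"
      by (intro nn_integral_cong) (auto simp: indicator_def power2_eq_square)
    also have "\<dots> = ennreal (K / 2)"
      unfolding L'[symmetric] by (rule nn_integral_eq_integral[OF I]) simp
    finally show ?thesis .
  qed
  have quarter: "(\<integral>\<^sup>+x\<in>(torus_cell :: (real^'d) set). ennreal (1 / 4) \<partial>lborel) = ennreal (K / 4)"
    by (subst nn_integral_cmult_indicator)
       (use K in \<open>simp_all add: emK ennreal_mult[symmetric] torus_cell_borel\<close>)
  show ?thesis
  proof (cases "p = \<infinity>")
    case True
    define E where "E = esssup (restrict_space lborel torus_cell) (\<lambda>x. ennreal (norm (f x)))"
    have "ennreal (B / 2) \<le> E"
    proof (rule ccontr)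
      assume "\<not> ennreal (B / 2) \<le> E"
      then have E: "E < ennreal (B / 2)" by simp
      have "0 < B / 2"
      proof (rule ccontr)
        assume "\<not> 0 < B / 2"
        then have "ennreal (B / 2) = 0" by (intro ennreal_neg) simp
        then show False using E by simp
      qed
      have "AE x in restrict_space lborel torus_cell. ennreal (norm (f x)) \<le> E"
        unfolding E_def by (rule esssup_AE)
      then have ae: "AE x in lborel. x \<in> torus_cell \<longrightarrow> ennreal (norm (f x)) \<le> E"
        by (subst (asm) AE_restrict_space_iff) (auto simp: torus_cell_def)
      have sq: "(c x)\<^sup>2 \<le> 1 / 4" if "ennreal (norm (f x)) \<le> E" for x
      proof -
        have "ennreal (norm (f x)) < ennreal (B / 2)" using that E by (rule order.strict_trans1)
        then have "norm (f x) < B / 2" by (simp only: ennreal_less_iff[OF norm_ge_zero])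
        then have "B * \<bar>c x\<bar> < B / 2" unfolding f c_def .
        then have "\<bar>c x\<bar> \<le> 1 / 2" using \<open>0 < B / 2\<close> by (simp add: field_simps)
        then have "\<bar>c x\<bar>\<^sup>2 \<le> (1 / 2)\<^sup>2" by (intro power_mono) auto
        then show ?thesis by (simp add: power_divide)
      qed
      have "(\<integral>\<^sup>+x\<in>torus_cell. ennreal ((c x)\<^sup>2) \<partial>lborel)
          \<le> (\<integral>\<^sup>+x\<in>(torus_cell :: (real^'d) set). ennreal (1 / 4) \<partial>lborel)"
      proof (rule nn_integral_mono_AE, rule AE_mp[OF ae], rule AE_I2, rule impI)
        fix x :: "real^'d" assume "x \<in> torus_cell \<longrightarrow> ennreal (norm (f x)) \<le> E"
        then show "ennreal ((c x)\<^sup>2) * indicator torus_cell x \<le> ennreal (1 / 4) * indicator torus_cell x"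
          using sq[of x] by (auto simp: indicator_def intro!: ennreal_leI)
      qed
      then have "K / 2 \<le> K / 4" unfolding half quarter using K by (simp add: ennreal_le_iff)
      then show False using K by simp
    qed
    then show ?thesis using True by (simp add: torus_Lp_norm_def E_def)
  next
    case False
    then obtain r where r: "p = ereal r" "1 \<le> r"
      using p by (cases p) (auto simp: one_ereal_def)
    \<comment> \<open>a pointwise bound by \<open>1/4\<close> plus the density of \<open>X\<close> leaves at least \<open>K/4\<close> of the mean value for \<open>X\<close>\<close>
    define X where "X = (\<integral>\<^sup>+x\<in>torus_cell. ennreal ((2 * \<bar>c x\<bar>) powr r) \<partial>lborel)"
    have pointwise: "(c x)\<^sup>2 \<le> 1 / 4 + (2 * \<bar>c x\<bar>) powr r" for x
    proof (cases "\<bar>c x\<bar> \<le> 1 / 2")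
      case True
      then have "\<bar>c x\<bar>\<^sup>2 \<le> (1 / 2)\<^sup>2" by (intro power_mono) auto
      then have "(c x)\<^sup>2 \<le> 1 / 4" by (simp add: power_divide)
      moreover have "0 \<le> (2 * \<bar>c x\<bar>) powr r" by simp
      ultimately show ?thesis by linarith
    next
      case False
      then have "1 \<le> (2 * \<bar>c x\<bar>) powr r" using r by (intro ge_one_powr_ge_zero) auto
      moreover have "(c x)\<^sup>2 \<le> 1" by (simp add: c_def abs_square_le_1)
      ultimately show ?thesis by linarith
    qed
    have "ennreal (K / 2) \<le> (\<integral>\<^sup>+x. ennreal (1 / 4) * indicator torus_cell x
        + ennreal ((2 * \<bar>c x\<bar>) powr r) * indicator torus_cell x \<partial>lborel)"
      unfolding half[symmetric]
      using pointwise by (intro nn_integral_mono)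
        (auto simp: indicator_def ennreal_plus[symmetric] simp del: ennreal_plus intro!: ennreal_leI)
    also have "\<dots> = ennreal (K / 4) + X"
      unfolding quarter[symmetric] X_def by (rule nn_integral_add) auto
    finally have "ennreal (K / 4) + ennreal (K / 4) \<le> ennreal (K / 4) + X"
      using K by (simp add: ennreal_plus[symmetric] del: ennreal_plus)
    then have "ennreal (K / 4) \<le> X" by (simp add: ennreal_add_left_cancel_le)
    moreover have "1 \<le> ennreal (K / 4)" using K by (simp add: ennreal_ge_1)
    ultimately have X: "1 \<le> X" by (rule order_trans[rotated])
    have "ennreal ((B / 2) powr r) * 1 \<le> ennreal ((B / 2) powr r) * X"
      using X by (rule mult_left_mono) simp
    also have "\<dots> = (\<integral>\<^sup>+x. ennreal ((B / 2) powr r) * (ennreal ((2 * \<bar>c x\<bar>) powr r) * indicator torus_cell x) \<partial>lborel)"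
      unfolding X_def by (rule nn_integral_cmult[symmetric]) auto
    also have "\<dots> = (\<integral>\<^sup>+x\<in>torus_cell. ennreal (norm (f x) powr r) \<partial>lborel)"
    proof (rule nn_integral_cong)
      fix x :: "real^'d"
      have "(B / 2) powr r * (2 * \<bar>c x\<bar>) powr r = (norm (f x)) powr r"
        using B0 by (subst powr_mult[symmetric]) (auto simp: f c_def)
      then have "ennreal ((B / 2) powr r) * ennreal ((2 * \<bar>c x\<bar>) powr r) = ennreal (norm (f x) powr r)"
        by (simp add: ennreal_mult[symmetric])
      then show "ennreal ((B / 2) powr r) * (ennreal ((2 * \<bar>c x\<bar>) powr r) * indicator torus_cell x)
          = ennreal (norm (f x) powr r) * indicator torus_cell x"
        by (simp add: mult.assoc[symmetric])
    qed
    finally have "ennreal_powr (ennreal ((B / 2) powr r)) (1 / r) \<le> torus_Lp_norm p f"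
      unfolding torus_Lp_norm_def using r by (auto intro!: ennreal_powr_mono)
    then show ?thesis using B0 r by (simp add: ennreal_powr_ennreal powr_powr)
  qed
qed

lemma continuous_on_axis [continuous_intros]:
  fixes f :: "'a::topological_space \<Rightarrow> 'b::{topological_space, zero}"
  assumes "continuous_on S f"
  shows "continuous_on S (\<lambda>x. axis j (f x) :: 'b^'d)"
proof -
  have "continuous_on S (\<lambda>x. if i = j then f x else 0)" for i using assms by (cases "i = j") auto
  then show ?thesis unfolding axis_def by (intro continuous_on_vec_lambda)
qed

lemma norm_axis: "norm (axis j z :: 'b::real_normed_vector^'d) = norm z"
proof -
  have "(norm ((axis j z :: 'b^'d) $ i))\<^sup>2 = (if i = j then (norm z)\<^sup>2 else 0)" for i
    by (auto simp: axis_def)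
  then show ?thesis by (simp add: norm_vec_def L2_set_def)
qed

text \<open>Only the blocks \<open>0\<close> and \<open>m\<close> are nonzero, so the sequence norm has two terms and, up to the factor
  \<open>2\<close>, is their sum for every \<open>q\<close>. The mean velocity \<open>a\<close> enters without the weight \<open>2\<^sup>m\<^sup>s\<close>, the amplitude
  \<open>b\<close> with it: this disparity is what makes the counterexample work.\<close>

lemma besov_norm_shear:
  fixes \<phi>\<^sub>0 :: "real^'d \<Rightarrow> real"
  assumes bump: "bump_function \<phi>\<^sub>0" and ij: "i \<noteq> j" and m: "0 < m" and p: "1 \<le> p" and q: "1 \<le> q"
  shows "besov_norm \<phi>\<^sub>0 s p q (regular_distribution (shear i j a b (2 ^ m) \<theta>))
      \<le> ennreal (2 * (2 * pi) ^ CARD('d) * (\<bar>a\<bar> + 2 powr (real m * s) * \<bar>b\<bar>))" (is "?N \<le> _")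
    and "ennreal (2 powr (real m * s) * \<bar>b\<bar> / 2)
      \<le> besov_norm \<phi>\<^sub>0 s p q (regular_distribution (shear i j a b (2 ^ m) \<theta>))"
proof -
  define K where "K = (2 * pi) ^ CARD('d)"
  have K: "0 \<le> K" by (simp add: K_def)
  define W where "W = 2 powr (real m * s)"
  define F where "F = regular_distribution (shear i j a b (2 ^ m) \<theta>)"
  define A where "A r = ennreal (2 powr (real r * s)) * torus_Lp_norm p (lp_block \<phi>\<^sub>0 r F)" for r :: nat
  define \<alpha> where "\<alpha> = K * \<bar>a\<bar>"
  define \<beta> where "\<beta> = W * (K * \<bar>b\<bar>)"
  have ab: "0 \<le> \<alpha>" "0 \<le> \<beta>" using K by (simp_all add: \<alpha>_def \<beta>_def W_def)
  have block: "lp_block \<phi>\<^sub>0 r F = (\<lambda>x. (if r = 0 then axis i (of_real a) else 0)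
      + (if r = m then axis j (of_real (b * cos (real (2 ^ m) * x $ i - \<theta>))) else 0))" for r
    using lp_block_shear[OF bump ij m] unfolding F_def by blast
  have cont: "continuous_on UNIV (lp_block \<phi>\<^sub>0 r F)" for r
    unfolding block by (cases "r = 0"; cases "r = m") (auto intro!: continuous_intros)
  have norm_m: "norm (lp_block \<phi>\<^sub>0 m F x) = \<bar>b\<bar> * \<bar>cos (real (2 ^ m) * x $ i - \<theta>)\<bar>" for x
    using m by (simp add: block norm_axis abs_mult norm_mult)
  have A_le: "A r \<le> ennreal (if r = 0 then \<alpha> else if r = m then \<beta> else 0)" for r
  proof -
    have "norm (lp_block \<phi>\<^sub>0 r F x) \<le> (if r = 0 then \<bar>a\<bar> else if r = m then \<bar>b\<bar> else 0)" for x
    proof (cases "r = m")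
      case True
      then show ?thesis using norm_m[of x] m by (simp add: mult_left_le)
    next
      case False
      then show ?thesis by (simp add: block norm_axis)
    qed
    from torus_Lp_norm_le[OF p cont this]
    have "A r \<le> ennreal (2 powr (real r * s)) * ennreal (K * (if r = 0 then \<bar>a\<bar> else if r = m then \<bar>b\<bar> else 0))"
      unfolding A_def K_def by (intro mult_left_mono) auto
    also have "\<dots> = ennreal (if r = 0 then \<alpha> else if r = m then \<beta> else 0)"
      using m K by (auto simp: \<alpha>_def \<beta>_def W_def ennreal_mult[symmetric])
    finally show ?thesis .
  qed
  have A_ge: "ennreal (W * \<bar>b\<bar> / 2) \<le> A m"
  proof -
    have "ennreal (\<bar>b\<bar> / 2) \<le> torus_Lp_norm p (lp_block \<phi>\<^sub>0 m F)"
      by (rule torus_Lp_norm_cos_ge[OF p _ _ norm_m]) auto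
    then have "ennreal W * ennreal (\<bar>b\<bar> / 2) \<le> A m"
      unfolding A_def W_def by (rule mult_left_mono) simp
    then show ?thesis by (simp add: ennreal_mult[symmetric] W_def)
  qed
  have norm_eq: "besov_norm \<phi>\<^sub>0 s p q F = (if q = \<infinity> then (SUP r. A r)
     else ennreal_powr (\<Sum>r. ennreal_powr (A r) (real_of_ereal q)) (1 / real_of_ereal q))"
    by (simp add: besov_norm_def A_def[abs_def] Let_def)
  have "besov_norm \<phi>\<^sub>0 s p q F \<le> ennreal (2 * (\<alpha> + \<beta>)) \<and> ennreal (W * \<bar>b\<bar> / 2) \<le> besov_norm \<phi>\<^sub>0 s p q F"
  proof (cases "q = \<infinity>")
    case True
    have "(SUP r. A r) \<le> ennreal (2 * (\<alpha> + \<beta>))"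
    proof (rule SUP_least)
      fix r
      have "(if r = 0 then \<alpha> else if r = m then \<beta> else 0) \<le> 2 * (\<alpha> + \<beta>)" using ab by auto
      then show "A r \<le> ennreal (2 * (\<alpha> + \<beta>))" using A_le order_trans ennreal_leI by blast
    qed
    moreover have "ennreal (W * \<bar>b\<bar> / 2) \<le> (SUP r. A r)"
      using A_ge by (rule SUP_upper2[rotated]) simp
    ultimately show ?thesis unfolding norm_eq using True by simp
  next
    case False
    then obtain t where t: "q = ereal t" "1 \<le> t"
      using q by (cases q) (auto simp: one_ereal_def)
    define \<Sigma> where "\<Sigma> = (\<Sum>r. ennreal_powr (A r) t)"
    have "\<Sigma> \<le> (\<Sum>r. ennreal ((if r = 0 then \<alpha> else if r = m then \<beta> else 0) powr t))"
      unfolding \<Sigma>_def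
    proof (rule suminf_le)
      fix r
      have "ennreal_powr (A r) t \<le> ennreal_powr (ennreal (if r = 0 then \<alpha> else if r = m then \<beta> else 0)) t"
        by (rule ennreal_powr_mono[OF A_le]) (use t in simp)
      also have "\<dots> = ennreal ((if r = 0 then \<alpha> else if r = m then \<beta> else 0) powr t)"
        by (rule ennreal_powr_ennreal) (use ab in auto)
      finally show "ennreal_powr (A r) t \<le> ennreal ((if r = 0 then \<alpha> else if r = m then \<beta> else 0) powr t)" .
    qed auto
    also have "\<dots> = (\<Sum>r\<in>{0, m}. ennreal ((if r = 0 then \<alpha> else if r = m then \<beta> else 0) powr t))"
      by (rule suminf_finite) auto
    also have "\<dots> = ennreal (\<alpha> powr t + \<beta> powr t)" using m by simp
    also have "\<dots> \<le> ennreal (2 * (\<alpha> + \<beta>) powr t)"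
      using powr_mono2[of t \<alpha> "\<alpha> + \<beta>"] powr_mono2[of t \<beta> "\<alpha> + \<beta>"] ab t by (intro ennreal_leI) simp
    finally have "ennreal_powr \<Sigma> (1 / t) \<le> ennreal_powr (ennreal (2 * (\<alpha> + \<beta>) powr t)) (1 / t)"
      using t by (intro ennreal_powr_mono) auto
    also have "\<dots> = ennreal ((2 * (\<alpha> + \<beta>) powr t) powr (1 / t))"
      by (rule ennreal_powr_ennreal) auto
    also have "(2 * (\<alpha> + \<beta>) powr t) powr (1 / t) = 2 powr (1 / t) * (\<alpha> + \<beta>)"
      using ab t by (simp add: powr_mult powr_powr)
    also have "\<dots> \<le> 2 * (\<alpha> + \<beta>)"
      using powr_mono[of "1 / t" 1 2] ab t by (intro mult_right_mono) auto
    finally have 1: "ennreal_powr \<Sigma> (1 / t) \<le> ennreal (2 * (\<alpha> + \<beta>))" by (simp add: ennreal_leI)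
    have "ennreal ((W * \<bar>b\<bar> / 2) powr t) = ennreal_powr (ennreal (W * \<bar>b\<bar> / 2)) t"
      by (simp add: ennreal_powr_ennreal W_def)
    also have "\<dots> \<le> ennreal_powr (A m) t" using A_ge t by (intro ennreal_powr_mono) auto
    also have "\<dots> \<le> \<Sigma>" unfolding \<Sigma>_def
      using sum_le_suminf[of "\<lambda>r. ennreal_powr (A r) t" "{m}"] by simp
    finally have "ennreal_powr (ennreal ((W * \<bar>b\<bar> / 2) powr t)) (1 / t) \<le> ennreal_powr \<Sigma> (1 / t)"
      using t by (intro ennreal_powr_mono) auto
    then have 2: "ennreal (W * \<bar>b\<bar> / 2) \<le> ennreal_powr \<Sigma> (1 / t)"
      using t by (simp add: ennreal_powr_ennreal powr_powr W_def)
    show ?thesis using 1 2 False t unfolding norm_eq \<Sigma>_def by simp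
  qed
  then show "?N \<le> ennreal (2 * (2 * pi) ^ CARD('d) * (\<bar>a\<bar> + 2 powr (real m * s) * \<bar>b\<bar>))"
    and "ennreal (2 powr (real m * s) * \<bar>b\<bar> / 2) \<le> ?N"
    unfolding F_def \<alpha>_def \<beta>_def W_def K_def by (simp_all add: algebra_simps)
qed

section \<open>Drifting shear waves as Euler solutions\<close>

lemma has_derivative_shear:
  "(shear i j a b n \<theta> has_derivative
     (\<lambda>h. (- b * sin (real n * x $ i - \<theta>) * (real n * h $ i)) *\<^sub>R axis j 1)) (at x)"
proof -
  have "((\<lambda>x. x $ i) has_derivative (\<lambda>h. h $ i)) (at x)"
    by (rule bounded_linear.has_derivative[OF bounded_linear_vec_nth has_derivative_ident])
  then show ?thesis unfolding shear_def[abs_def]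
    by (auto intro!: derivative_eq_intros)
qed

lemma partial_shear:
  "partial l (shear i j a b n \<theta>) x
    = (if l = i then - b * real n * sin (real n * x $ i - \<theta>) else 0) *\<^sub>R axis j 1"
  unfolding partial_eqI[OF has_derivative_shear] by (auto simp: axis_def)

lemma shear_C1:
  shows "shear i j a b n \<theta> differentiable (at x)"
    and "torus_periodic (shear i j a b n \<theta>)"
    and "continuous_on S (partial l (shear i j a b n \<theta>))"
    and "i \<noteq> j \<Longrightarrow> (\<Sum>l\<in>UNIV. partial l (shear i j a b n \<theta>) x $ l) = 0"
proof -
  show "shear i j a b n \<theta> differentiable (at x)"
    using has_derivative_shear unfolding differentiable_def by blast
  have "cos (real n * (x + axis l (2 * pi)) $ i - \<theta>) = cos (real n * x $ i - \<theta>)" for x l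
  proof (cases "l = i")
    case True
    have "real n * (x + axis l (2 * pi)) $ i - \<theta> = (real n * x $ i - \<theta>) + 2 * pi * of_int (int n)"
      by (simp add: True algebra_simps)
    then show ?thesis by (simp only: cos_add_int_period)
  qed (simp add: axis_def)
  then show "torus_periodic (shear i j a b n \<theta>)"
    unfolding torus_periodic_def shear_def by simp
  have "partial l (shear i j a b n \<theta>)
    = (\<lambda>x. (if l = i then - b * real n * sin (real n * x $ i - \<theta>) else 0) *\<^sub>R axis j 1)"
    using partial_shear by blast
  then show "continuous_on S (partial l (shear i j a b n \<theta>))"
    by (cases "l = i") (auto intro!: continuous_intros)
  show "(\<Sum>l\<in>UNIV. partial l (shear i j a b n \<theta>) x $ l) = 0" if "i \<noteq> j"
    unfolding partial_shear using that by (intro sum.neutral) (auto simp: axis_def)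
qed

text \<open>A difference of cosines of equal frequency is again a cosine, with an amplitude governed by the
  phase difference.\<close>

lemma shear_diff:
  "shear i j a b n \<theta> x - shear i j a' b n \<theta>' x
    = shear i j (a - a') (2 * b * sin ((\<theta> - \<theta>') / 2)) n ((\<theta> + \<theta>') / 2 + pi / 2) x"
proof -
  define y where "y = real n * x $ i"
  have "cos (y - \<theta>) - cos (y - \<theta>') = 2 * sin ((y - \<theta> + (y - \<theta>')) / 2) * sin ((y - \<theta>' - (y - \<theta>)) / 2)"
    by (rule cos_diff_cos)
  also have "(y - \<theta> + (y - \<theta>')) / 2 = y - (\<theta> + \<theta>') / 2" by (simp add: field_simps)
  also have "y - \<theta>' - (y - \<theta>) = \<theta> - \<theta>'" by simp
  also have "sin (y - (\<theta> + \<theta>') / 2) = cos (y - ((\<theta> + \<theta>') / 2 + pi / 2))"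
  proof -
    have "cos (z - pi / 2) = sin z" for z :: real unfolding cos_diff by simp
    from this[of "y - (\<theta> + \<theta>') / 2"] show ?thesis by (simp add: diff_diff_eq)
  qed
  finally have "b * cos (y - \<theta>) - b * cos (y - \<theta>')
      = 2 * b * sin ((\<theta> - \<theta>') / 2) * cos (y - ((\<theta> + \<theta>') / 2 + pi / 2))"
    by (simp only: right_diff_distrib[symmetric] mult_ac)
  then show ?thesis unfolding shear_def y_def[symmetric]
    by (simp only: scaleR_diff_left[symmetric] add_diff_add)
qed

lemma regular_distribution_shear_diff:
  "regular_distribution (shear i j a b n \<theta>) - regular_distribution (shear i j a' b n \<theta>')
    = regular_distribution (shear i j (a - a') (2 * b * sin ((\<theta> - \<theta>') / 2)) n ((\<theta> + \<theta>') / 2 + pi / 2))"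
  unfolding regular_distribution_diff[OF continuous_on_shear continuous_on_shear] shear_diff ..

text \<open>The wave moves with speed \<open>a\<close>, which changes its phase by \<open>n a t\<close>. Only \<open>\<partial>\<^sub>i u\<close> is nonzero and
  \<open>u\<^sub>i = a\<close> is constant, so the nonlinearity is \<open>a \<partial>\<^sub>i u\<close> and zero pressure balances the equation.\<close>

lemma classical_euler_shear:
  fixes i j :: "'d::finite"
  assumes "i \<noteq> j" and T: "0 < T"
  shows "classical_euler T (\<lambda>t. shear i j a b n (real n * a * t)) (\<lambda>t x. 0)"
proof -
  have dt: "((\<lambda>\<tau>. shear i j a b n (real n * a * \<tau>) x) has_vector_derivative
      (b * (real n * a) * sin (real n * x $ i - real n * a * t)) *\<^sub>R axis j 1) (at t within {0..T})" for t x
  proof -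
    have "((\<lambda>\<tau>. b * cos (real n * x $ i - real n * a * \<tau>)) has_real_derivative
        b * (real n * a) * sin (real n * x $ i - real n * a * t)) (at t within {0..T})"
      by (rule derivative_eq_intros refl | simp)+
    from has_vector_derivative_add[OF has_vector_derivative_const
        has_vector_derivative_scaleR[OF this has_vector_derivative_const]]
    show ?thesis unfolding shear_def by simp
  qed
  have dt': "vector_derivative (\<lambda>\<tau>. shear i j a b n (real n * a * \<tau>) x) (at t within {0..T})
      = (b * (real n * a) * sin (real n * x $ i - real n * a * t)) *\<^sub>R axis j 1" if "t \<in> {0..T}" for t x
    using vector_derivative_within_cbox[of 0 T t, unfolded cbox_interval, OF T _ dt] that by simp
  have grad: "gradient (\<lambda>x. 0) x = 0" for x :: "real^'d" by (simp add: gradient_def vec_eq_iff)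
  have transport: "(\<Sum>l\<in>UNIV. shear i j a b n \<theta> x $ l *\<^sub>R partial l (shear i j a b n \<theta>) x)
      = (- (b * (real n * a) * sin (real n * x $ i - \<theta>))) *\<^sub>R axis j 1" for \<theta> x
  proof -
    define y where "y = sin (real n * x $ i - \<theta>)"
    have "shear i j a b n \<theta> x $ l *\<^sub>R partial l (shear i j a b n \<theta>) x
        = (if l = i then (- (b * (real n * a) * y)) *\<^sub>R axis j 1 else 0)" for l
      unfolding partial_shear y_def[symmetric] using assms(1) by (simp add: shear_nth)
    then show ?thesis unfolding y_def[symmetric] by simp
  qed
  show ?thesis
    unfolding classical_euler_def
  proof (intro conjI ballI allI)
    fix t x assume t: "t \<in> {0..T}"
    show "(\<lambda>\<tau>. shear i j a b n (real n * a * \<tau>) x) differentiable (at t within {0..T})"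
      using dt by (rule differentiableI_vector)
    show "vector_derivative (\<lambda>\<tau>. shear i j a b n (real n * a * \<tau>) x) (at t within {0..T})
        + (\<Sum>l\<in>UNIV. shear i j a b n (real n * a * t) x $ l *\<^sub>R partial l (shear i j a b n (real n * a * t)) x)
        + gradient (\<lambda>x. 0) x = 0"
      unfolding dt'[OF t] transport grad by simp
  next
    show "continuous_on ({0..T} \<times> UNIV) (\<lambda>(t, x). shear i j a b n (real n * a * t) x)"
      unfolding shear_def case_prod_beta by (intro continuous_intros)
    show "continuous_on ({0..T} \<times> UNIV) (\<lambda>(t, x). partial l (shear i j a b n (real n * a * t)) x)" for l
      unfolding partial_shear case_prod_beta by (cases "l = i") (auto intro!: continuous_intros)
    have "continuous_on ({0..T} \<times> UNIV)
      (\<lambda>(t, x). (b * (real n * a) * sin (real n * x $ i - real n * a * t)) *\<^sub>R (axis j 1 :: real^'d))"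
      unfolding case_prod_beta by (intro continuous_intros)
    then show "continuous_on ({0..T} \<times> UNIV)
        (\<lambda>(t, x). vector_derivative (\<lambda>\<tau>. shear i j a b n (real n * a * \<tau>) x) (at t within {0..T}))"
      by (rule continuous_on_eq) (auto simp: dt')
  qed (simp_all add: shear_C1 assms(1), simp add: torus_periodic_def)
qed

text \<open>A solution is a curve of distributions, and its representatives are only known to agree at time
  zero as distributions. Test functions turn this into equality on the cell, and the energy
  estimate propagates it.\<close>

lemma euler_solution_unique:
  fixes U\<^sub>0 :: "'d::finite vdistr"
  assumes U: "euler_solution \<phi>\<^sub>0 s p q T U\<^sub>0 U" and V: "euler_solution \<phi>\<^sub>0 s p q T U\<^sub>0 V" and T: "0 < T"
  shows "U = V"
proof (rule extensionalityI)
  show "U \<in> extensional {0..T}" "V \<in> extensional {0..T}"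
    using U V by (auto simp: euler_solution_def)
  obtain u \<pi> where u: "classical_euler T u \<pi>" "\<And>t. t \<in> {0..T} \<Longrightarrow> U t = regular_distribution (u t)"
    using U by (auto simp: euler_solution_def)
  obtain v \<rho> where v: "classical_euler T v \<rho>" "\<And>t. t \<in> {0..T} \<Longrightarrow> V t = regular_distribution (v t)"
    using V by (auto simp: euler_solution_def)
  have "continuous_on ({0..T} \<times> UNIV) (\<lambda>(t, x). u t x)" "continuous_on ({0..T} \<times> UNIV) (\<lambda>(t, x). v t x)"
    using u(1) v(1) unfolding classical_euler_def by blast+
  from this[THEN continuous_on_slice, of 0 UNIV] T
  have cont: "continuous_on UNIV (u 0)" "continuous_on UNIV (v 0)" by auto
  have "regular_distribution (u 0) = regular_distribution (v 0)"
    using U V u(2)[of 0] v(2)[of 0] T by (simp add: euler_solution_def)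
  then have init: "u 0 x = v 0 x" if "x \<in> torus_cell" for x
    using regular_distribution_inj[OF cont _ that] by blast
  show "U t = V t" if t: "t \<in> {0..T}" for t
    unfolding u(2)[OF t] v(2)[OF t]
    by (rule regular_distribution_cong) (rule classical_euler_unique[OF u(1) v(1) T init t])
qed

text \<open>What remains to be shown is continuity in time: by \<open>regular_distribution_shear_diff\<close> the difference
  at two times is a shear wave without mean velocity, whose amplitude tends to zero.\<close>

lemma shear_euler_solution:
  fixes \<phi>\<^sub>0 :: "real^'d \<Rightarrow> real"
  assumes bump: "bump_function \<phi>\<^sub>0" and ij: "i \<noteq> j" and m: "0 < m" and p: "1 \<le> p" and q: "1 \<le> q"
    and T: "0 < T"
  shows "euler_solution \<phi>\<^sub>0 s p q T (regular_distribution (shear i j a b (2 ^ m) 0))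
    (restrict (\<lambda>t. regular_distribution (shear i j a b (2 ^ m) (real (2 ^ m) * a * t))) {0..T})"
proof -
  define n where "n = (2::nat) ^ m"
  define U where "U t = regular_distribution (shear i j a b n (real n * a * t))" for t
  define C where "C = 2 * (2 * pi) ^ CARD('d) * 2 powr (real m * s)"
  have space: "U t \<in> besov_space \<phi>\<^sub>0 s p q" for t
    using regular_distribution_in_distributions[OF continuous_on_shear]
      le_less_trans[OF besov_norm_shear(1)[OF bump ij m p q] ennreal_less_top]
    unfolding besov_space_def U_def n_def by auto
  have no_mean: "besov_norm \<phi>\<^sub>0 s p q (regular_distribution (shear i j 0 \<beta> n \<gamma>)) \<le> ennreal (C * \<bar>\<beta>\<bar>)" for \<beta> \<gamma>
    using besov_norm_shear(1)[OF bump ij m p q, of s 0 \<beta> \<gamma>] unfolding n_def C_def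
    by (simp only: abs_zero add_0_left mult.assoc)
  have diff: "besov_norm \<phi>\<^sub>0 s p q (U \<tau> - U t)
      \<le> ennreal (C * \<bar>2 * b * sin ((real n * a * \<tau> - real n * a * t) / 2)\<bar>)" for \<tau> t
    unfolding U_def regular_distribution_shear_diff diff_self by (rule no_mean)
  have "((\<lambda>\<tau>. besov_norm \<phi>\<^sub>0 s p q (U \<tau> - U t)) \<longlongrightarrow> 0) (at t within {0..T})" for t
  proof (rule tendsto_sandwich[OF _ _ tendsto_const])
    have "((\<lambda>\<tau>. C * \<bar>2 * b * sin ((real n * a * \<tau> - real n * a * t) / 2)\<bar>) \<longlongrightarrow>
        C * \<bar>2 * b * sin ((real n * a * t - real n * a * t) / 2)\<bar>) (at t within {0..T})"
      by (intro tendsto_intros) auto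
    then have "((\<lambda>\<tau>. C * \<bar>2 * b * sin ((real n * a * \<tau> - real n * a * t) / 2)\<bar>) \<longlongrightarrow> 0) (at t within {0..T})"
      by simp
    from tendsto_ennrealI[OF this]
    show "((\<lambda>\<tau>. ennreal (C * \<bar>2 * b * sin ((real n * a * \<tau> - real n * a * t) / 2)\<bar>)) \<longlongrightarrow> 0) (at t within {0..T})"
      by (simp only: ennreal_0)
  qed (auto intro: always_eventually diff)
  then have "((\<lambda>\<tau>. besov_norm \<phi>\<^sub>0 s p q (restrict U {0..T} \<tau> - U t)) \<longlongrightarrow> 0) (at t within {0..T})" for t
    by (rule Lim_transform_within[OF _ zero_less_one]) auto
  then have "besov_curve \<phi>\<^sub>0 s p q T (restrict U {0..T})"
    unfolding besov_curve_def using space by simp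
  then have "euler_solution \<phi>\<^sub>0 s p q T (U 0) (restrict U {0..T})"
    unfolding euler_solution_def using classical_euler_shear[OF ij T, of a b n] T
    by (auto simp: U_def intro!: exI[of _ "\<lambda>t. shear i j a b n (real n * a * t)"])
  then show ?thesis by (simp add: U_def[abs_def] n_def)
qed

lemma shear_in_euler_data_ball:
  fixes \<phi>\<^sub>0 :: "real^'d \<Rightarrow> real"
  assumes bump: "bump_function \<phi>\<^sub>0" and ij: "i \<noteq> j" and m: "0 < m" and p: "1 \<le> p" and q: "1 \<le> q"
    and T: "0 < T" and small: "2 * (2 * pi) ^ CARD('d) * (\<bar>a\<bar> + 2 powr (real m * s) * \<bar>b\<bar>) < 1"
  shows "regular_distribution (shear i j a b (2 ^ m) 0) \<in> euler_data_ball \<phi>\<^sub>0 s p q T"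
    and "data_to_solution \<phi>\<^sub>0 s p q T (regular_distribution (shear i j a b (2 ^ m) 0))
      = restrict (\<lambda>t. regular_distribution (shear i j a b (2 ^ m) (real (2 ^ m) * a * t))) {0..T}"
proof -
  define U\<^sub>0 where "U\<^sub>0 = regular_distribution (shear i j a b (2 ^ m) 0)"
  note sol = shear_euler_solution[OF bump ij m p q T, of s a b, folded U\<^sub>0_def]
  have norm: "besov_norm \<phi>\<^sub>0 s p q U\<^sub>0 < 1"
    unfolding U\<^sub>0_def using besov_norm_shear(1)[OF bump ij m p q]
    by (rule le_less_trans) (use small in \<open>simp add: ennreal_less_one_iff\<close>)
  have "U\<^sub>0 \<in> besov_space \<phi>\<^sub>0 s p q"
    using norm regular_distribution_in_distributions[OF continuous_on_shear]
    unfolding besov_space_def U\<^sub>0_def by (auto intro: order.strict_trans)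
  moreover have "divergence_free U\<^sub>0"
    unfolding U\<^sub>0_def by (rule regular_distribution_divergence_free) (auto simp: shear_C1 ij)
  ultimately show "U\<^sub>0 \<in> euler_data_ball \<phi>\<^sub>0 s p q T"
    unfolding euler_data_ball_def using norm sol euler_solution_unique[OF _ _ T] by blast
  show "data_to_solution \<phi>\<^sub>0 s p q T U\<^sub>0
      = restrict (\<lambda>t. regular_distribution (shear i j a b (2 ^ m) (real (2 ^ m) * a * t))) {0..T}"
    unfolding data_to_solution_def using sol euler_solution_unique[OF _ sol T] by (rule the_equality)
qed

section \<open>Failure of uniform continuity\<close>

theorem theorem1:
  fixes s T :: real and p q :: ereal and \<phi>\<^sub>0 :: "real^'d \<Rightarrow> real"
  assumes "CARD('d) = 2 \<or> CARD('d) = 3"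
    and "1 \<le> p" and "1 \<le> q"
    and "1 + ereal (real CARD('d)) / p < ereal s"
    and "bump_function \<phi>\<^sub>0"
    and "0 < T"
  shows "\<not> (\<forall>\<epsilon>::real>0. \<exists>\<delta>::real>0.
    \<forall>U\<^sub>0\<in>euler_data_ball \<phi>\<^sub>0 s p q T. \<forall>V\<^sub>0\<in>euler_data_ball \<phi>\<^sub>0 s p q T.
      besov_norm \<phi>\<^sub>0 s p q (U\<^sub>0 - V\<^sub>0) < ennreal \<delta> \<longrightarrow>
      (SUP t\<in>{0..T}. besov_norm \<phi>\<^sub>0 s p q
         (data_to_solution \<phi>\<^sub>0 s p q T U\<^sub>0 t - data_to_solution \<phi>\<^sub>0 s p q T V\<^sub>0 t)) < ennreal \<epsilon>)"
proof
  assume uniform: "\<forall>\<epsilon>::real>0. \<exists>\<delta>::real>0.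
    \<forall>U\<^sub>0\<in>euler_data_ball \<phi>\<^sub>0 s p q T. \<forall>V\<^sub>0\<in>euler_data_ball \<phi>\<^sub>0 s p q T.
      besov_norm \<phi>\<^sub>0 s p q (U\<^sub>0 - V\<^sub>0) < ennreal \<delta> \<longrightarrow>
      (SUP t\<in>{0..T}. besov_norm \<phi>\<^sub>0 s p q
         (data_to_solution \<phi>\<^sub>0 s p q T U\<^sub>0 t - data_to_solution \<phi>\<^sub>0 s p q T V\<^sub>0 t)) < ennreal \<epsilon>"
  note hyps = \<open>bump_function \<phi>\<^sub>0\<close> \<open>1 \<le> p\<close> \<open>1 \<le> q\<close> \<open>0 < T\<close>
  obtain i j :: 'd where ij: "i \<noteq> j"
  proof -
    have "\<not> CARD('d) \<le> Suc 0" using assms(1) by auto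
    then show ?thesis using that by (auto simp: card_le_Suc0_iff_eq)
  qed
  define K where "K = 2 * (2 * pi) ^ CARD('d)"
  have K: "0 < K" by (simp add: K_def)
  \<comment> \<open>the wave takes at most a quarter of the unit ball, \<open>K c = 1/4\<close>, and \<open>\<eta>\<close> below leaves less than a quarter to the mean\<close>
  define c where "c = 1 / (4 * K)"
  have c: "0 < c" using K by (simp add: c_def)
  \<comment> \<open>by time \<open>t\<^sub>0 \<le> 1 < \<pi>\<close> the phases \<open>\<plusminus>t\<^sub>0\<close> have separated without returning to each other\<close>
  define t\<^sub>0 where "t\<^sub>0 = min T 1"
  have t0: "t\<^sub>0 \<in> {0..T}" "0 < t\<^sub>0" "t\<^sub>0 \<le> 1" using \<open>0 < T\<close> by (auto simp: t\<^sub>0_def)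
  have sin_pos: "0 < sin t\<^sub>0" using t0 pi_gt3 by (intro sin_gt_zero) auto
  have "0 < c * sin t\<^sub>0" using c sin_pos by (rule mult_pos_pos)
  then obtain \<delta> where \<delta>: "0 < \<delta>"
    and close: "\<forall>U\<^sub>0\<in>euler_data_ball \<phi>\<^sub>0 s p q T. \<forall>V\<^sub>0\<in>euler_data_ball \<phi>\<^sub>0 s p q T.
      besov_norm \<phi>\<^sub>0 s p q (U\<^sub>0 - V\<^sub>0) < ennreal \<delta> \<longrightarrow>
      (SUP t\<in>{0..T}. besov_norm \<phi>\<^sub>0 s p q
         (data_to_solution \<phi>\<^sub>0 s p q T U\<^sub>0 t - data_to_solution \<phi>\<^sub>0 s p q T V\<^sub>0 t))
        < ennreal (c * sin t\<^sub>0)"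
    by (rule uniform[THEN spec, THEN mp, THEN exE]) (elim conjE)
  define \<eta> where "\<eta> = min (\<delta> / (2 * K)) (1 / (4 * K))"
  have "0 < \<eta>" using \<delta> K by (simp add: \<eta>_def)
  then obtain m' where "(1 / 2) ^ m' < \<eta>" using real_arch_pow_inv[of \<eta> "1/2"] by auto
  then have m': "(1 / 2) ^ (Suc m') < \<eta>" using \<open>0 < \<eta>\<close> by simp
  define m where "m = Suc m'"
  have m: "0 < m" by (simp add: m_def)
  \<comment> \<open>the angular velocity \<open>2\<^sup>m a\<close> of the phase is then \<open>1\<close>, whatever \<open>m\<close> is\<close>
  define a where "a = 1 / real (2 ^ m)"
  have a: "0 < a" "a < \<eta>" "real (2 ^ m) * a = 1"
    using m' by (simp_all add: a_def m_def power_divide)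
  define b where "b = c / 2 powr (real m * s)"
  have b: "2 powr (real m * s) * \<bar>b\<bar> = c" using c by (simp add: b_def)
  define U\<^sub>0 where "U\<^sub>0 a = regular_distribution (shear i j a b (2 ^ m) 0)" for a
  have small: "2 * (2 * pi) ^ CARD('d) * (\<bar>a'\<bar> + 2 powr (real m * s) * \<bar>b\<bar>) < 1" if "\<bar>a'\<bar> = a" for a'
  proof -
    have "a < 1 / (4 * K)" using a(2) by (simp add: \<eta>_def)
    then have "K * (a + c) < K * (1 / (4 * K) + 1 / (4 * K))"
      using K by (intro mult_strict_left_mono) (auto simp: c_def)
    also have "\<dots> = 1 / 2" using K by (simp add: field_simps)
    finally show ?thesis unfolding b that K_def[symmetric] by simp
  qed
  have ball: "U\<^sub>0 a' \<in> euler_data_ball \<phi>\<^sub>0 s p q T" if "\<bar>a'\<bar> = a" for a'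
    unfolding U\<^sub>0_def using hyps by (intro shear_in_euler_data_ball ij m small that) auto
  have flow: "data_to_solution \<phi>\<^sub>0 s p q T (U\<^sub>0 a') t\<^sub>0
      = regular_distribution (shear i j a' b (2 ^ m) (real (2 ^ m) * a' * t\<^sub>0))" if "\<bar>a'\<bar> = a" for a'
    unfolding U\<^sub>0_def using shear_in_euler_data_ball(2)[OF hyps(1) ij m hyps(2,3,4) small[OF that]] t0(1) by simp
  have "besov_norm \<phi>\<^sub>0 s p q (U\<^sub>0 a - U\<^sub>0 (- a)) \<le> ennreal (K * (2 * a))"
    using besov_norm_shear(1)[OF hyps(1) ij m hyps(2,3), of s "a - (- a)" 0] a(1)
    unfolding U\<^sub>0_def regular_distribution_shear_diff K_def by simp
  also have "K * (2 * a) < \<delta>"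
  proof -
    have "a < \<delta> / (2 * K)" using a(2) by (simp add: \<eta>_def)
    then show ?thesis using K by (simp add: field_simps)
  qed
  then have "ennreal (K * (2 * a)) < ennreal \<delta>" using a(1) K by (intro ennreal_lessI) (auto simp: \<delta>)
  finally have near: "besov_norm \<phi>\<^sub>0 s p q (U\<^sub>0 a - U\<^sub>0 (- a)) < ennreal \<delta>" .
  have far: "ennreal (c * sin t\<^sub>0) \<le> besov_norm \<phi>\<^sub>0 s p q
      (data_to_solution \<phi>\<^sub>0 s p q T (U\<^sub>0 a) t\<^sub>0 - data_to_solution \<phi>\<^sub>0 s p q T (U\<^sub>0 (- a)) t\<^sub>0)"
  proof -
    define \<beta> where "\<beta> = 2 * b * sin ((real (2 ^ m) * a * t\<^sub>0 - real (2 ^ m) * (- a) * t\<^sub>0) / 2)"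
    have "\<beta> = 2 * b * sin t\<^sub>0" unfolding \<beta>_def using a(3) by (simp add: mult.assoc[symmetric])
    then have "2 powr (real m * s) * \<bar>\<beta>\<bar> / 2 = 2 powr (real m * s) * \<bar>b\<bar> * sin t\<^sub>0"
      using sin_pos by (simp add: abs_mult)
    then have eq: "2 powr (real m * s) * \<bar>\<beta>\<bar> / 2 = c * sin t\<^sub>0" unfolding b .
    have "\<bar>a\<bar> = a" "\<bar>- a\<bar> = a" using a(1) by auto
    then show ?thesis
      unfolding flow[OF \<open>\<bar>a\<bar> = a\<close>] flow[OF \<open>\<bar>- a\<bar> = a\<close>] regular_distribution_shear_diff \<beta>_def[symmetric]
        eq[symmetric]
      by (intro besov_norm_shear(2) hyps ij m)
  qed
  have "ennreal (c * sin t\<^sub>0) \<le> (SUP t\<in>{0..T}. besov_norm \<phi>\<^sub>0 s p q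
      (data_to_solution \<phi>\<^sub>0 s p q T (U\<^sub>0 a) t - data_to_solution \<phi>\<^sub>0 s p q T (U\<^sub>0 (- a)) t))"
    using t0(1) far by (rule SUP_upper2)
  also have "\<dots> < ennreal (c * sin t\<^sub>0)"
    by (rule close[rule_format, OF ball ball near]) (use a(1) in simp_all)
  finally show False by simp
qed

end
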